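(* Let $K$ be a field of characteristic zero and let $\lambda\in K$. The partial compositions $\circ_{v,\lambda}$ on weighted labelled rooted trees, together with the symmetric group actions by relabelling and the unit $\mathbf{1}=\sum_{n\ge1}\bullet_n$ (all defined in the context), yield a structure of multigraded operad on $\mathcal{O}^\lambda$.
   Context: $\mathbb{N}^*=\{1,2,\ldots\}$. An operad means a symmetric operad in $K$-vector spaces: spaces $\mathcal{O}_n$ ($n\ge1$) with right $S_n$-actions, partial compositions $\circ_i$ and a unit in $\mathcal{O}_1$, satisfying the usual nested and disjoint associativity, unit and equivariance axioms. An operad $\mathcal{O}$ is multigraded if $\mathcal{O}_n=\prod_{a_1,\ldots,a_n\in\mathbb{N}^*}\mathcal{O}_{n,a_1,\ldots,a_n}$ for every $n\geq 1$, where: (i) $(\mathcal{O}_{n,a_1,\ldots,a_n}).\sigma=\mathcal{O}_{n,a_{\sigma(1)},\ldots,a_{\sigma(n)}}$ for all $\sigma\in S_n$; (ii) $\circ_i$ maps $\mathcal{O}_{n,a_1,\ldots,a_n}\otimes\mathcal{O}_{m,b_1,\ldots,b_m}$ to $\mathcal{O}_{n+m-1,a_1,\ldots,a_{i-1},b_1,\ldots,b_m,a_{i+1},\ldots,a_n}$, and its image is zero if $\sum_{j} b_j\ne a_i$. Weighted trees: consider (non-planar) rooted trees $T$ with $n$ vertices labelled bijectively by $\{1,\ldots,n\}$, each vertex $v$ carrying a weight $|v|\in\mathbb{N}^*$. Edges are oriented towards the root. Let $v(T)$ be the vertex set, $|T|=\sum_{v\in v(T)}|v|$ the weight of $T$,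 $h(v)$ the number of edges on the path from $v$ to the root, and $d(T)=\sum_{v\in v(T)}|v|h(v)$ the potential energy. Let $E(T,v)$ be the set of edges of $T$ arriving at $v$ (from its children). Let $\mathcal{O}^\lambda_{n,a_1,\ldots,a_n}$ be the vector space spanned by such trees in which the vertex labelled $i$ has weight $a_i$, and put $\mathcal{O}^\lambda_n=\prod_{a_1,\ldots,a_n}\mathcal{O}^\lambda_{n,a_1,\ldots,a_n}$. The element $\sigma\in S_n$ acts on the right by permuting labels (the vertex labelled $i$ in $T$ gets label $\sigma^{-1}(i)$ in $T.\sigma$). Compositions: for trees $S$ (with $n$ vertices) and $T$ (with $m$ vertices), a vertex $v$ of $S$ and a map $f:E(S,v)\to v(T)$, the tree $S\circ_v^f T$ is obtained by replacing $v$ by $T$ and connecting each edge $e\in E(S,v)$ to the vertex $f(e)$ of $T$. If $v$ is not the root of $S$, the edge leaving $v$ now leaves the root of $T$; if $v$ is the root of $S$, the root of the new tree is the root of $T$. Weights are kept. If $v$ has label $i$, labels of $S$ less than $i$ are kept, those of $T$ are increased by $i-1$, and those of $S$ greater than $i$ are increased by $m-1$. Let $f_0$ be the map sending every edge of $E(S,v)$ to the root of $T$. Then $$S\circ_{v,\lambda}T=\sum_{f:E(S,v)\to v(T)}\lambda^{d(S\circ_v^fT)-d(S\circ_v^{f_0}T)}\,S\circ_v^fT\quad\text{if }|T|=|v|,$$ and $S\circ_{v,\lambda}T=0$ otherwise. The exponents are non-negative integers, and $0^0=1$. The operadic composition $\circ_i$ is $\circ_{v,\lambda}$ with $v$ the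 vertex of label $i$, extended bilinearly and componentwise to the products (each component of the result involves only finitely many terms). $\bullet_n$ is the one-vertex tree of weight $n$. *)

theory Defs
  imports
    Complex_Main
    "HOL-Combinatorics.Permutations"
    "HOL-Library.Function_Algebras"
    "HOL-Library.FuncSet"
begin

section \<open>Symmetric operads in vector spaces\<close>

text \<open>
  Labels are 1-based. When a structure with \<open>m\<close> labels is inserted at label \<open>i\<close>, a label
  \<open>j \<noteq> i\<close> of the outer structure becomes \<open>outer_label i m j\<close> and a label \<open>j\<close> of the inserted
  structure becomes \<open>inner_label i j\<close>.
\<close>

definition outer_label :: "nat \<Rightarrow> nat \<Rightarrow> nat \<Rightarrow> nat" where
  "outer_label i m j = (if j < i then j else j + m - 1)"

definition inner_label :: "nat \<Rightarrow> nat \<Rightarrow> nat" where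
  "inner_label i j = j + i - 1"

text \<open>
  The block permutation \<open>\<sigma> \<circ>\<^sub>i \<tau>\<close> of \<open>{1..n+m-1}\<close>, for \<open>\<sigma> \<in> S\<^sub>n\<close> and \<open>\<tau> \<in> S\<^sub>m\<close>, that occurs in
  the equivariance axiom \<open>(x.\<sigma>) \<circ>\<^sub>i (y.\<tau>) = (x \<circ>\<^bsub>\<sigma>(i)\<^esub> y).(\<sigma> \<circ>\<^sub>i \<tau>)\<close>. The block \<open>{i..i+m-1}\<close> is sent
  to the block starting at \<open>\<sigma> i\<close> by means of \<open>\<tau>\<close>; the other positions are permuted by \<open>\<sigma>\<close>.
\<close>

definition perm_comp ::
    "nat \<Rightarrow> nat \<Rightarrow> nat \<Rightarrow> (nat \<Rightarrow> nat) \<Rightarrow> (nat \<Rightarrow> nat) \<Rightarrow> nat \<Rightarrow> nat" where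
  "perm_comp n m i \<sigma> \<tau> k =
     (if k \<notin> {1..n + m - 1} then k
      else if k < i then outer_label (\<sigma> i) m (\<sigma> k)
      else if k < i + m then inner_label (\<sigma> i) (\<tau> (k + 1 - i))
      else outer_label (\<sigma> i) m (\<sigma> (k + 1 - m)))"

text \<open>
  The spaces \<open>Op n\<close>, \<open>n \<ge> 1\<close>, are subspaces of one ambient vector space. They need not be disjoint,
  so the operations carry the arities as arguments: \<open>act n x \<sigma>\<close> is \<open>x.\<sigma>\<close> for \<open>x \<in> Op n\<close>, and
  \<open>comp n m i x y\<close> is \<open>x \<circ>\<^sub>i y\<close> for \<open>x \<in> Op n\<close> and \<open>y \<in> Op m\<close>. Nothing is required of the operations
  outside these carriers, nor of \<open>Op 0\<close>.
\<close>

locale operad = vector_space scale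
  for scale :: "'k::field \<Rightarrow> 'v::ab_group_add \<Rightarrow> 'v" (infixr "*s" 75) +
  fixes Op :: "nat \<Rightarrow> 'v set"
    and act :: "nat \<Rightarrow> 'v \<Rightarrow> (nat \<Rightarrow> nat) \<Rightarrow> 'v"
    and comp :: "nat \<Rightarrow> nat \<Rightarrow> nat \<Rightarrow> 'v \<Rightarrow> 'v \<Rightarrow> 'v"
    and unit_elt :: 'v
  assumes subspace_Op: "1 \<le> n \<Longrightarrow> subspace (Op n)"
    \<comment> \<open>linear right actions of the symmetric groups\<close>
    and act_closed:
      "\<lbrakk>1 \<le> n; \<sigma> permutes {1..n}; x \<in> Op n\<rbrakk> \<Longrightarrow> act n x \<sigma> \<in> Op n"
    and act_add:
      "\<lbrakk>1 \<le> n; \<sigma> permutes {1..n}; x \<in> Op n; x' \<in> Op n\<rbrakk>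
        \<Longrightarrow> act n (x + x') \<sigma> = act n x \<sigma> + act n x' \<sigma>"
    and act_scale:
      "\<lbrakk>1 \<le> n; \<sigma> permutes {1..n}; x \<in> Op n\<rbrakk> \<Longrightarrow> act n (c *s x) \<sigma> = c *s act n x \<sigma>"
    and act_id: "\<lbrakk>1 \<le> n; x \<in> Op n\<rbrakk> \<Longrightarrow> act n x id = x"
    and act_act:
      "\<lbrakk>1 \<le> n; \<sigma> permutes {1..n}; \<tau> permutes {1..n}; x \<in> Op n\<rbrakk>
        \<Longrightarrow> act n (act n x \<sigma>) \<tau> = act n x (\<sigma> \<circ> \<tau>)"
    \<comment> \<open>bilinear partial compositions\<close>
    and comp_closed:
      "\<lbrakk>1 \<le> i; i \<le> n; 1 \<le> m; x \<in> Op n; y \<in> Op m\<rbrakk> \<Longrightarrow> comp n m i x y \<in> Op (n + m - 1)"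
    and comp_add_left:
      "\<lbrakk>1 \<le> i; i \<le> n; 1 \<le> m; x \<in> Op n; x' \<in> Op n; y \<in> Op m\<rbrakk>
        \<Longrightarrow> comp n m i (x + x') y = comp n m i x y + comp n m i x' y"
    and comp_scale_left:
      "\<lbrakk>1 \<le> i; i \<le> n; 1 \<le> m; x \<in> Op n; y \<in> Op m\<rbrakk>
        \<Longrightarrow> comp n m i (c *s x) y = c *s comp n m i x y"
    and comp_add_right:
      "\<lbrakk>1 \<le> i; i \<le> n; 1 \<le> m; x \<in> Op n; y \<in> Op m; y' \<in> Op m\<rbrakk>
        \<Longrightarrow> comp n m i x (y + y') = comp n m i x y + comp n m i x y'"
    and comp_scale_right:
      "\<lbrakk>1 \<le> i; i \<le> n; 1 \<le> m; x \<in> Op n; y \<in> Op m\<rbrakk>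
        \<Longrightarrow> comp n m i x (c *s y) = c *s comp n m i x y"
    and comp_nested:
      "\<lbrakk>1 \<le> i; i \<le> n; 1 \<le> j; j \<le> m; 1 \<le> p; x \<in> Op n; y \<in> Op m; z \<in> Op p\<rbrakk>
        \<Longrightarrow> comp (n + m - 1) p (i - 1 + j) (comp n m i x y) z
          = comp n (m + p - 1) i x (comp m p j y z)"
    and comp_disjoint:
      "\<lbrakk>1 \<le> i; i < k; k \<le> n; 1 \<le> m; 1 \<le> p; x \<in> Op n; y \<in> Op m; z \<in> Op p\<rbrakk>
        \<Longrightarrow> comp (n + m - 1) p (k - 1 + m) (comp n m i x y) z
          = comp (n + p - 1) m i (comp n p k x z) y"
    and unit_closed: "unit_elt \<in> Op 1"
    and unit_left: "\<lbrakk>1 \<le> n; x \<in> Op n\<rbrakk> \<Longrightarrow> comp 1 n 1 unit_elt x = x"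
    and unit_right: "\<lbrakk>1 \<le> i; i \<le> n; x \<in> Op n\<rbrakk> \<Longrightarrow> comp n 1 i x unit_elt = x"
    and comp_equivariant:
      "\<lbrakk>1 \<le> i; i \<le> n; 1 \<le> m; \<sigma> permutes {1..n}; \<tau> permutes {1..m}; x \<in> Op n; y \<in> Op m\<rbrakk>
        \<Longrightarrow> comp n m i (act n x \<sigma>) (act m y \<tau>)
          = act (n + m - 1) (comp n m (\<sigma> i) x y) (perm_comp n m i \<sigma> \<tau>)"


section \<open>Multigraded operads\<close>

text \<open>The multidegrees \<open>(a\<^sub>1, \<dots>, a\<^sub>n)\<close> of arity \<open>n\<close>, with entries in \<open>{1, 2, \<dots>}\<close>.\<close>

definition multidegrees :: "nat \<Rightarrow> nat list set" where
  "multidegrees n = {a. length a = n \<and> (\<forall>k\<in>set a. 1 \<le> k)}"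

definition perm_degree :: "nat list \<Rightarrow> (nat \<Rightarrow> nat) \<Rightarrow> nat list" where
  "perm_degree a \<sigma> = map (\<lambda>i. a ! (\<sigma> i - 1)) [1..<length a + 1]"

definition insert_degree :: "nat \<Rightarrow> nat list \<Rightarrow> nat list \<Rightarrow> nat list" where
  "insert_degree i a b = take (i - 1) a @ b @ drop i a"

text \<open>
  \<open>Gr a\<close> is the component of multidegree \<open>a\<close>; its arity is \<open>length a\<close>. That \<open>Op n\<close> is the product of
  the \<open>Gr a\<close> is expressed internally: the \<open>Gr a\<close> are subspaces of \<open>Op n\<close>, the maps
  \<open>proj a\<close> are linear, the families \<open>(proj a x)\<^sub>a\<close> identify \<open>Op n\<close> with the full Cartesian product,
  and \<open>Gr a\<close> is embedded in this product as the factor of index \<open>a\<close>.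
\<close>

locale multigraded_operad = operad scale Op act comp unit_elt
  for scale :: "'k::field \<Rightarrow> 'v::ab_group_add \<Rightarrow> 'v" (infixr "*s" 75)
    and Op :: "nat \<Rightarrow> 'v set"
    and act :: "nat \<Rightarrow> 'v \<Rightarrow> (nat \<Rightarrow> nat) \<Rightarrow> 'v"
    and comp :: "nat \<Rightarrow> nat \<Rightarrow> nat \<Rightarrow> 'v \<Rightarrow> 'v \<Rightarrow> 'v"
    and unit_elt :: 'v +
  fixes Gr :: "nat list \<Rightarrow> 'v set"
    and proj :: "nat list \<Rightarrow> 'v \<Rightarrow> 'v"
  assumes subspace_Gr: "\<lbrakk>1 \<le> n; a \<in> multidegrees n\<rbrakk> \<Longrightarrow> subspace (Gr a)"
    and Gr_subset: "\<lbrakk>1 \<le> n; a \<in> multidegrees n\<rbrakk> \<Longrightarrow> Gr a \<subseteq> Op n"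
    and proj_add:
      "\<lbrakk>1 \<le> n; a \<in> multidegrees n; x \<in> Op n; y \<in> Op n\<rbrakk> \<Longrightarrow> proj a (x + y) = proj a x + proj a y"
    and proj_scale:
      "\<lbrakk>1 \<le> n; a \<in> multidegrees n; x \<in> Op n\<rbrakk> \<Longrightarrow> proj a (c *s x) = c *s proj a x"
    and proj_same:
      "\<lbrakk>1 \<le> n; a \<in> multidegrees n; x \<in> Gr a\<rbrakk> \<Longrightarrow> proj a x = x"
    and proj_other:
      "\<lbrakk>1 \<le> n; a \<in> multidegrees n; b \<in> multidegrees n; a \<noteq> b; x \<in> Gr a\<rbrakk> \<Longrightarrow> proj b x = 0"
    and Op_product:
      "1 \<le> n \<Longrightarrow> bij_betw (\<lambda>x. \<lambda>a\<in>multidegrees n. proj a x) (Op n) (\<Pi>\<^sub>E a\<in>multidegrees n. Gr a)"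
    and Gr_act:
      "\<lbrakk>1 \<le> n; a \<in> multidegrees n; \<sigma> permutes {1..n}\<rbrakk>
        \<Longrightarrow> (\<lambda>x. act n x \<sigma>) ` Gr a = Gr (perm_degree a \<sigma>)"
    and Gr_comp:
      "\<lbrakk>1 \<le> i; i \<le> n; 1 \<le> m; a \<in> multidegrees n; b \<in> multidegrees m; x \<in> Gr a; y \<in> Gr b\<rbrakk>
        \<Longrightarrow> comp n m i x y \<in> Gr (insert_degree i a b)"
    and Gr_comp_zero:
      "\<lbrakk>1 \<le> i; i \<le> n; 1 \<le> m; a \<in> multidegrees n; b \<in> multidegrees m; x \<in> Gr a; y \<in> Gr b;
        sum_list b \<noteq> a ! (i - 1)\<rbrakk> \<Longrightarrow> comp n m i x y = 0"


section \<open>Weighted labelled rooted trees\<close>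

text \<open>
  A tree with \<open>n\<close> vertices labelled by \<open>{1..n}\<close> is a tree on the vertex set \<open>{1..n}\<close>. The list
  \<open>weights T\<close> has length \<open>n\<close>, and vertex \<open>v\<close> has weight \<open>weights T ! (v - 1)\<close>. An edge is a pair
  (child, parent).
\<close>

datatype wtree = WTree (weights: "nat list") (edges: "(nat \<times> nat) set")

definition verts :: "wtree \<Rightarrow> nat set" where
  "verts T = {1..length (weights T)}"

definition weight :: "wtree \<Rightarrow> nat \<Rightarrow> nat" where
  "weight T v = weights T ! (v - 1)"

definition is_wtree :: "wtree \<Rightarrow> bool" where
  "is_wtree T \<longleftrightarrow>
     (\<forall>v\<in>verts T. 1 \<le> weight T v) \<and>
     edges T \<subseteq> verts T \<times> verts T \<and>
     (\<exists>r\<in>verts T. (\<forall>p. (r, p) \<notin> edges T) \<and>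
        (\<forall>v\<in>verts T - {r}. \<exists>!p. (v, p) \<in> edges T) \<and>
        (\<forall>v\<in>verts T. (v, r) \<in> (edges T)\<^sup>*))"

definition wtrees :: "nat \<Rightarrow> wtree set" where
  "wtrees n = {T. is_wtree T \<and> length (weights T) = n}"

definition tree_root :: "wtree \<Rightarrow> nat" where
  "tree_root T = (THE r. r \<in> verts T \<and> (\<forall>p. (r, p) \<notin> edges T))"

definition tree_weight :: "wtree \<Rightarrow> nat" where
  "tree_weight T = (\<Sum>v\<in>verts T. weight T v)"

definition height :: "wtree \<Rightarrow> nat \<Rightarrow> nat" where
  "height T v = (THE k. (v, tree_root T) \<in> edges T ^^ k)"

definition energy :: "wtree \<Rightarrow> nat" where
  "energy T = (\<Sum>v\<in>verts T. weight T v * height T v)"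

definition in_edges :: "wtree \<Rightarrow> nat \<Rightarrow> (nat \<times> nat) set" where
  "in_edges T v = {e \<in> edges T. snd e = v}"

definition relabel :: "wtree \<Rightarrow> (nat \<Rightarrow> nat) \<Rightarrow> wtree" where
  "relabel T \<sigma> = WTree (perm_degree (weights T) \<sigma>) (map_prod (inv \<sigma>) (inv \<sigma>) ` edges T)"

text \<open>The tree \<open>S \<circ>\<^sub>v\<^sup>f T\<close>, where \<open>v\<close> is the vertex of \<open>S\<close> with label \<open>i\<close>.\<close>

definition graft :: "nat \<Rightarrow> (nat \<times> nat \<Rightarrow> nat) \<Rightarrow> wtree \<Rightarrow> wtree \<Rightarrow> wtree" where
  "graft i f S T =
     (let out = outer_label i (length (weights T)); inn = inner_label i in
      WTree (insert_degree i (weights S) (weights T))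
        ({(out c, out p) | c p. (c, p) \<in> edges S \<and> c \<noteq> i \<and> p \<noteq> i} \<union>
         {(inn c, inn p) | c p. (c, p) \<in> edges T} \<union>
         {(out (fst e), inn (f e)) | e. e \<in> in_edges S i} \<union>
         {(inn (tree_root T), out p) | p. (i, p) \<in> edges S}))"


section \<open>The spaces and operations on weighted trees\<close>

text \<open>
  Vectors are functions giving the coefficient of each tree, with pointwise addition. As trees of
  different multidegrees are different, an element of the product over all multidegrees is also such
  a function, in general with infinite support.
\<close>

definition tscale :: "'k::field \<Rightarrow> (wtree \<Rightarrow> 'k) \<Rightarrow> wtree \<Rightarrow> 'k" where
  "tscale c x = (\<lambda>U. c * x U)"

definition basis_tree :: "wtree \<Rightarrow> wtree \<Rightarrow> 'k::field" where
  "basis_tree T = (\<lambda>U. if U = T then 1 else 0)"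

definition tree_Gr :: "nat list \<Rightarrow> (wtree \<Rightarrow> 'k::field) set" where
  "tree_Gr a = module.span tscale {basis_tree T | T. is_wtree T \<and> weights T = a}"

definition tree_proj :: "nat list \<Rightarrow> (wtree \<Rightarrow> 'k::field) \<Rightarrow> wtree \<Rightarrow> 'k" where
  "tree_proj a x = (\<lambda>U. if weights U = a then x U else 0)"

definition tree_Op :: "nat \<Rightarrow> (wtree \<Rightarrow> 'k::field) set" where
  "tree_Op n = {x. (\<forall>U. U \<notin> wtrees n \<longrightarrow> x U = 0) \<and> (\<forall>a\<in>multidegrees n. tree_proj a x \<in> tree_Gr a)}"

definition tree_act :: "nat \<Rightarrow> (wtree \<Rightarrow> 'k::field) \<Rightarrow> (nat \<Rightarrow> nat) \<Rightarrow> wtree \<Rightarrow> 'k" where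
  "tree_act n x \<sigma> = (\<lambda>U. \<Sum>T | T \<in> wtrees n \<and> relabel T \<sigma> = U. x T)"

text \<open>
  The composition of two trees. The subtraction on natural numbers in the exponent does not truncate:
  the energy is minimal when all edges are connected to the root of \<open>T\<close>.
\<close>

definition basis_comp :: "'k::field \<Rightarrow> nat \<Rightarrow> wtree \<Rightarrow> wtree \<Rightarrow> wtree \<Rightarrow> 'k" where
  "basis_comp lam i S T =
     (if tree_weight T = weight S i
      then \<Sum>f\<in>in_edges S i \<rightarrow>\<^sub>E verts T.
             tscale (lam ^ (energy (graft i f S T) - energy (graft i (\<lambda>_. tree_root T) S T)))
               (basis_tree (graft i f S T))
      else 0)"

text \<open>
  The coefficient of a tree \<open>U\<close> in \<open>x \<circ>\<^sub>i y\<close>. The sum over pairs is finite (lemma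
  \<open>finite_comp_pairs\<close> below) since the weights of \<open>U\<close> determine those of \<open>S\<close> and \<open>T\<close>.
\<close>

definition tree_comp ::
    "'k::field \<Rightarrow> nat \<Rightarrow> nat \<Rightarrow> nat \<Rightarrow> (wtree \<Rightarrow> 'k) \<Rightarrow> (wtree \<Rightarrow> 'k) \<Rightarrow> wtree \<Rightarrow> 'k" where
  "tree_comp lam n m i x y =
     (\<lambda>U. \<Sum>(S, T) | S \<in> wtrees n \<and> T \<in> wtrees m \<and> basis_comp lam i S T U \<noteq> 0.
            x S * y T * basis_comp lam i S T U)"

text \<open>The infinite sum of all one-vertex trees, in the product over all multidegrees of arity 1.\<close>

definition tree_unit :: "wtree \<Rightarrow> 'k::field" where
  "tree_unit = (\<lambda>U. if \<exists>k\<ge>1. U = WTree [k] {} then 1 else 0)"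

lemma finite_wtrees_weights: "finite {T. is_wtree T \<and> weights T = a}"
proof -
  have "{T. is_wtree T \<and> weights T = a} \<subseteq> WTree a ` Pow ({1..length a} \<times> {1..length a})"
  proof
    fix T assume "T \<in> {T. is_wtree T \<and> weights T = a}"
    then show "T \<in> WTree a ` Pow ({1..length a} \<times> {1..length a})"
      by (cases T) (auto simp: is_wtree_def verts_def)
  qed
  then show ?thesis by (rule finite_subset) auto
qed

lemma finite_comp_pairs:
  assumes "1 \<le> i" and "i \<le> n"
  shows "finite {(S, T). S \<in> wtrees n \<and> T \<in> wtrees m \<and> basis_comp lam i S T U \<noteq> 0}"
    (is "finite ?A")
proof -
  define w where "w = weights U"
  define b where "b = take m (drop (i - 1) w)"
  define a where "a = take (i - 1) w @ [sum_list b] @ drop (i - 1 + m) w"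
  have "weights S = a \<and> weights T = b"
    if S: "S \<in> wtrees n" and T: "T \<in> wtrees m" and nz: "basis_comp lam i S T U \<noteq> 0" for S T
  proof -
    have wt: "tree_weight T = weight S i"
      using nz by (auto simp: basis_comp_def split: if_splits)
    have "\<exists>f. U = graft i f S T"
    proof (rule ccontr)
      assume "\<nexists>f. U = graft i f S T"
      then have "\<And>f. basis_tree (graft i f S T) U = (0 :: 'a)"
        by (auto simp: basis_tree_def)
      moreover have "(\<Sum>f\<in>F. g f) U = (\<Sum>f\<in>F. g f U)"
        for F :: "(nat \<times> nat \<Rightarrow> nat) set" and g :: "_ \<Rightarrow> wtree \<Rightarrow> 'a"
        by (induction F rule: infinite_finite_induct) auto
      ultimately show False
        using nz by (simp add: basis_comp_def wt tscale_def)
    qed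
    then have w: "w = take (i - 1) (weights S) @ weights T @ drop i (weights S)"
      by (auto simp: w_def graft_def Let_def insert_degree_def)
    have len: "length (weights S) = n" "length (weights T) = m"
      using S T by (auto simp: wtrees_def)
    have b: "weights T = b"
      using len assms by (simp add: b_def w)
    have "sum_list b = tree_weight T"
      unfolding tree_weight_def b[symmetric] sum_list_sum_nth verts_def weight_def
      by (rule sum.reindex_bij_witness[of _ "\<lambda>v. v - 1" Suc]) auto
    then have "sum_list b = weights S ! (i - 1)"
      using wt by (simp add: weight_def)
    then have "a = take (i - 1) (weights S) @ [weights S ! (i - 1)] @ drop i (weights S)"
      using len assms by (simp add: a_def w)
    also have "\<dots> = weights S"
      using len assms id_take_nth_drop[of "i - 1" "weights S"] by simp
    finally show ?thesis
      using b by simp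
  qed
  then have "?A \<subseteq> {S. is_wtree S \<and> weights S = a} \<times> {T. is_wtree T \<and> weights T = b}"
    by (auto simp: wtrees_def)
  then show ?thesis
    by (rule finite_subset) (auto intro: finite_wtrees_weights)
qed

end

theory Submission
  imports Defs
begin

text \<open>
  The point is that the exponent of \<open>\<lambda>\<close> is a coboundary. If \<open>|T| = |v|\<close> and all edges arriving at
  \<open>v\<close> are connected to the root of \<open>T\<close>, then the vertices of \<open>S\<close> keep their heights while those of
  \<open>T\<close> are lifted by \<open>h(v)\<close>; the energy this costs, \<open>|T| h(v)\<close>, is the contribution of the vertex \<open>v\<close>
  which has disappeared. So the energy of this reference tree is \<open>d(S) + d(T)\<close>, and a tree
  \<open>U = S \<circ>\<^sub>v\<^sup>f T\<close> occurs in the composition with coefficient \<open>\<lambda>\<^bsup>d(U) - d(S) - d(T)\<^esup>\<close>. In an iterated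
  composition the energies of the intermediate trees cancel: the coefficient is \<open>\<lambda>\<close> to the energy of
  the result minus the energies of the three factors, in whatever order they are composed.
  The cancellation takes place in exponents which are natural numbers, as it has to for \<open>\<lambda> = 0\<close>; this
  is why the inequality \<open>d(U) \<ge> d(S) + d(T)\<close> (\<open>energy_contract_restrict_le\<close>) is needed.

  What remains is which trees occur, and the inverse of grafting answers this. The vertices of \<open>T\<close>
  become a block \<open>B\<close> of consecutive labels of \<open>U\<close>, and \<open>T\<close> is the restriction \<open>U|B\<close>, \<open>S\<close> is the
  contraction \<open>U/B\<close>, and \<open>f\<close> records the parents in \<open>B\<close> of the vertices outside. Conversely every tree \<open>U\<close>
  for which \<open>U|B\<close> is a tree arises from exactly one triple \<open>(S, T, f)\<close>. In coordinates the
  composition is therefore not a sum but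
  \<open>(x \<circ>\<^sub>i y)(U) = \<lambda>\<^bsup>d(U) - d(U/B) - d(U|B)\<^esup> x(U/B) y(U|B)\<close> if \<open>U|B\<close> is a tree, and \<open>0\<close> otherwise
  (\<open>tree_comp_eval\<close>).

  The axioms become identities between contractions, restrictions and relabellings. Contraction and
  relabelling are direct images under maps of labels (\<open>push_tree\<close>) and restriction is an inverse image
  (\<open>pull_tree\<close>); functoriality (\<open>push_push\<close>, \<open>pull_pull\<close>) and base change (\<open>pull_push\<close>) reduce all
  of them to identities between maps of labels. One point is about trees: for a block \<open>C \<subseteq> B\<close>, one side of
  the nested associativity requires \<open>U|B\<close> to be a tree and the other side \<open>(U|B)/C\<close>. The locale
  \<open>subtree_contraction\<close> shows that these are equivalent once \<open>U|C\<close> is a tree, and also compares heights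
  before and after the contraction.
\<close>

section \<open>Rooted trees as relations\<close>

definition arborescence :: "'a set \<Rightarrow> ('a \<times> 'a) set \<Rightarrow> 'a \<Rightarrow> bool" where
  "arborescence V E r \<longleftrightarrow>
     E \<subseteq> V \<times> V \<and> r \<in> V \<and> (\<forall>p. (r, p) \<notin> E) \<and> (\<forall>v\<in>V - {r}. \<exists>!p. (v, p) \<in> E) \<and>
     (\<forall>v\<in>V. (v, r) \<in> E\<^sup>*)"

definition depth :: "('a \<times> 'a) set \<Rightarrow> 'a \<Rightarrow> 'a \<Rightarrow> nat" where
  "depth E r v = (THE k. (v, r) \<in> E ^^ k)"

lemma arborescenceD:
  assumes "arborescence V E r"
  shows arborescence_edges: "E \<subseteq> V \<times> V"
    and arborescence_root_in: "r \<in> V"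
    and arborescence_no_parent: "(r, p) \<notin> E"
    and arborescence_parent: "v \<in> V \<Longrightarrow> v \<noteq> r \<Longrightarrow> \<exists>p. (v, p) \<in> E"
    and arborescence_reaches: "v \<in> V \<Longrightarrow> (v, r) \<in> E\<^sup>*"
proof -
  have *: "E \<subseteq> V \<times> V \<and> r \<in> V \<and> (\<forall>p. (r, p) \<notin> E) \<and> (\<forall>v\<in>V - {r}. \<exists>!p. (v, p) \<in> E) \<and>
     (\<forall>v\<in>V. (v, r) \<in> E\<^sup>*)"
    using assms unfolding arborescence_def .
  show "E \<subseteq> V \<times> V" "r \<in> V" "(r, p) \<notin> E"
    using * by simp_all
  show "v \<in> V \<Longrightarrow> (v, r) \<in> E\<^sup>*"
    using * by simp
  assume "v \<in> V" "v \<noteq> r"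
  then have "\<exists>!p. (v, p) \<in> E"
    using * by simp
  then show "\<exists>p. (v, p) \<in> E"
    by (rule ex1_implies_ex)
qed

lemma arborescence_parent_unique:
  assumes "arborescence V E r" "(v, p) \<in> E" "(v, q) \<in> E"
  shows "p = q"
proof -
  have "v \<in> V - {r}"
    using arborescence_edges[OF assms(1)] arborescence_no_parent[OF assms(1)] assms(2) by auto
  then have "\<exists>!p. (v, p) \<in> E"
    using assms(1) unfolding arborescence_def by simp
  then show ?thesis
    using assms(2,3) by auto
qed

lemma arborescence_irrefl:
  assumes "arborescence V E r"
  shows "(v, v) \<notin> E"
proof
  assume loop: "(v, v) \<in> E"
  have "y = v" if "(v, y) \<in> E\<^sup>*" for y
    using that by induction (use arborescence_parent_unique[OF assms loop] in auto)
  then have "r = v"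
    using arborescence_reaches[OF assms] arborescence_edges[OF assms] loop by auto
  then show False
    using arborescence_no_parent[OF assms] loop by auto
qed

text \<open>Both relations are graphs of parent functions, and a vertex has a parent unless it is the
  root; so adding edges to a tree on the same vertices destroys it.\<close>

lemma arborescence_subset_eq:
  assumes "arborescence V E r" "arborescence V E' r'" "E \<subseteq> E'"
  shows "E = E'"
proof -
  have r: "r = r'"
  proof (rule ccontr)
    assume "r \<noteq> r'"
    then obtain p where "(r', p) \<in> E"
      using arborescence_parent[OF assms(1) arborescence_root_in[OF assms(2)]] by auto
    then show False
      using assms(3) arborescence_no_parent[OF assms(2)] by blast
  qed
  have "(x, y) \<in> E" if xy: "(x, y) \<in> E'" for x y
  proof -
    have "x \<in> V" "x \<noteq> r"
      using arborescence_edges[OF assms(2)] arborescence_no_parent[OF assms(2)] xy r by auto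
    then obtain z where "(x, z) \<in> E"
      using arborescence_parent[OF assms(1)] by blast
    then show ?thesis
      using arborescence_parent_unique[OF assms(2) xy] assms(3) by blast
  qed
  then show ?thesis
    using assms(3) by auto
qed

lemma arborescence_image:
  assumes tree: "arborescence V E r" and inj: "inj_on f V"
  shows "arborescence (f ` V) (map_prod f f ` E) (f r)"
  unfolding arborescence_def
proof (intro conjI ballI allI)
  note EV = arborescence_edges[OF tree] and rV = arborescence_root_in[OF tree]
  show "map_prod f f ` E \<subseteq> f ` V \<times> f ` V" "f r \<in> f ` V"
    using EV rV by auto
  have lift: "\<exists>q. (v, q) \<in> E \<and> p = f q" if "(f v, p) \<in> map_prod f f ` E" "v \<in> V" for v p
  proof -
    obtain x y where xy: "(x, y) \<in> E" "f v = f x" "p = f y"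
      using \<open>(f v, p) \<in> map_prod f f ` E\<close> by auto
    then have "v = x"
      using EV inj \<open>v \<in> V\<close> by (auto dest: inj_onD)
    then show ?thesis
      using xy by auto
  qed
  show "(f r, p) \<notin> map_prod f f ` E" for p
  proof
    assume "(f r, p) \<in> map_prod f f ` E"
    from lift[OF this rV] show False
      using arborescence_no_parent[OF tree] by blast
  qed
  fix x
  show "\<exists>!p. (x, p) \<in> map_prod f f ` E" if "x \<in> f ` V - {f r}"
  proof -
    obtain v where v: "v \<in> V" "x = f v" "v \<noteq> r"
      using \<open>x \<in> f ` V - {f r}\<close> by auto
    then obtain p where p: "(v, p) \<in> E"
      using arborescence_parent[OF tree] by blast
    show ?thesis
    proof (intro ex1I)
      show "(x, f p) \<in> map_prod f f ` E"
        using p v by force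
      show "q = f p" if "(x, q) \<in> map_prod f f ` E" for q
      proof -
        have "(f v, q) \<in> map_prod f f ` E"
          using that v by simp
        from lift[OF this v(1)] show ?thesis
          using arborescence_parent_unique[OF tree p] by blast
      qed
    qed
  qed
  show "(x, f r) \<in> (map_prod f f ` E)\<^sup>*" if "x \<in> f ` V"
  proof -
    obtain v where v: "v \<in> V" "x = f v"
      using \<open>x \<in> f ` V\<close> by auto
    have "(v, r) \<in> E\<^sup>*"
      using arborescence_reaches[OF tree] v by auto
    then have "(f v, f r) \<in> (map_prod f f ` E)\<^sup>*"
    proof induction
      case (step y z)
      then have "(f y, f z) \<in> map_prod f f ` E"
        by force
      with step.IH show ?case
        by (rule rtrancl_into_rtrancl)
    qed auto
    then show ?thesis
      using v by simp
  qed
qed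

lemma depth_unique:
  assumes tree: "arborescence V E r"
  shows "(v, r) \<in> E ^^ k \<Longrightarrow> (v, r) \<in> E ^^ l \<Longrightarrow> k = l"
proof (induction k arbitrary: v l)
  case 0
  then have "v = r"
    by simp
  show ?case
  proof (cases l)
    case (Suc l')
    then obtain p where "(r, p) \<in> E"
      using "0.prems"(2) relpow_Suc_D2 unfolding \<open>v = r\<close> by metis
    then show ?thesis
      using arborescence_no_parent[OF tree] by blast
  qed simp
next
  case (Suc k)
  obtain p where p: "(v, p) \<in> E" "(p, r) \<in> E ^^ k"
    using relpow_Suc_D2[OF Suc.prems(1)] by blast
  then have "v \<noteq> r"
    using arborescence_no_parent[OF tree] by blast
  with Suc.prems(2) obtain l' where l: "l = Suc l'"
    by (cases l) auto
  obtain q where q: "(v, q) \<in> E" "(q, r) \<in> E ^^ l'"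
    using relpow_Suc_D2[OF Suc.prems(2)[unfolded l]] by blast
  then have "p = q"
    using arborescence_parent_unique[OF tree] p by blast
  then show ?case
    using Suc.IH p q l by blast
qed

lemma depth_eqI:
  assumes "arborescence V E r" "(v, r) \<in> E ^^ k"
  shows "depth E r v = k"
  unfolding depth_def using depth_unique[OF assms(1)] assms(2) by blast

lemma depth_root:
  assumes "arborescence V E r"
  shows "depth E r r = 0"
  by (rule depth_eqI[OF assms]) auto

lemma depth_edge:
  assumes "arborescence V E r" "(v, p) \<in> E"
  shows "depth E r v = Suc (depth E r p)"
proof -
  have "(p, r) \<in> E\<^sup>*"
    using arborescence_reaches[OF assms(1)] arborescence_edges[OF assms(1)] assms(2) by auto
  then obtain k where k: "(p, r) \<in> E ^^ k"
    by (auto dest: rtrancl_imp_relpow)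
  show ?thesis
    using depth_eqI[OF assms(1) k] depth_eqI[OF assms(1) relpow_Suc_I2[OF assms(2) k]] by simp
qed

text \<open>The recursion along edges determines the depth; the one-sided version gives a lower bound.\<close>

lemma depth_lower_bound:
  assumes tree: "arborescence V E r" and "v \<in> V"
    and "g r = 0" and "\<And>v p. (v, p) \<in> E \<Longrightarrow> g v \<le> Suc (g p)"
  shows "g v \<le> depth E r v"
proof -
  have "(v, r) \<in> E\<^sup>*"
    using arborescence_reaches[OF tree \<open>v \<in> V\<close>] .
  then show ?thesis
  proof (induction rule: converse_rtrancl_induct)
    case (step x y)
    then show ?case
      using assms(4)[of x y] depth_edge[OF tree, of x y] by linarith
  qed (use assms in simp)
qed

lemma depth_determined:
  assumes tree: "arborescence V E r" and "v \<in> V"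
    and "g r = 0" and "\<And>v p. (v, p) \<in> E \<Longrightarrow> g v = Suc (g p)"
  shows "g v = depth E r v"
proof -
  have "(v, r) \<in> E\<^sup>*"
    using arborescence_reaches[OF tree \<open>v \<in> V\<close>] .
  then show ?thesis
  proof (induction rule: converse_rtrancl_induct)
    case (step x y)
    then show ?case
      using assms(4)[of x y] depth_edge[OF tree, of x y] by simp
  qed (use assms depth_root[OF tree] in simp)
qed

lemma depth_image:
  assumes tree: "arborescence V E r" and inj: "inj_on f V" and "v \<in> V"
  shows "depth (map_prod f f ` E) (f r) (f v) = depth E r v"
proof (rule depth_determined[OF tree \<open>v \<in> V\<close>])
  note tree' = arborescence_image[OF tree inj]
  show "depth (map_prod f f ` E) (f r) (f r) = 0"
    by (rule depth_root[OF tree'])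
  show "depth (map_prod f f ` E) (f r) (f x) = Suc (depth (map_prod f f ` E) (f r) (f y))"
    if "(x, y) \<in> E" for x y
    by (rule depth_edge[OF tree']) (use that in force)
qed


section \<open>Contracting a subtree\<close>

text \<open>
  The map \<open>c\<close> collapses the vertex set \<open>B\<close> of a subtree with root \<open>t\<close> to the single vertex \<open>b\<close> and is
  injective elsewhere. The relation \<open>E\<close> need not be a tree here, since whether it is one is to be
  compared with whether its contraction is one.
\<close>

locale subtree_contraction =
  fixes V B :: "'a set" and E :: "('a \<times> 'a) set" and c :: "'a \<Rightarrow> 'b" and b :: 'b and t :: 'a
  assumes edges_in: "E \<subseteq> V \<times> V"
    and functional: "(v, p) \<in> E \<Longrightarrow> (v, q) \<in> E \<Longrightarrow> p = q"
    and irreflexive: "(v, v) \<notin> E"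
    and B_subset: "B \<subseteq> V"
    and subtree: "arborescence B (E \<inter> B \<times> B) t"
    and collapse_iff: "v \<in> V \<Longrightarrow> c v = b \<longleftrightarrow> v \<in> B"
    and collapse_inj: "inj_on c (V - B)"
begin

definition contracted :: "('b \<times> 'b) set" where
  "contracted = map_prod c c ` E - Id"

lemma t_in: "t \<in> B"
  using subtree by (rule arborescence_root_in)

lemma exit_from_root:
  assumes "(x, y) \<in> E" "x \<in> B" "y \<notin> B"
  shows "x = t"
proof (rule ccontr)
  assume "x \<noteq> t"
  then obtain z where "(x, z) \<in> E \<inter> B \<times> B"
    using arborescence_parent[OF subtree \<open>x \<in> B\<close>] by blast
  then show False
    using functional assms by blast
qed

lemma no_edge_t: "(t, p) \<in> E \<Longrightarrow> p \<notin> B"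
  using arborescence_no_parent[OF subtree] t_in by blast

lemma collapse_eq:
  assumes "c v = c w" "v \<in> V" "w \<in> V" "v \<notin> B"
  shows "v = w"
proof -
  have "w \<notin> B"
    using assms collapse_iff[of v] collapse_iff[of w] by auto
  then show ?thesis
    using assms collapse_inj by (auto dest: inj_onD)
qed

lemma contracted_iff:
  "(x, y) \<in> contracted \<longleftrightarrow> (\<exists>v p. (v, p) \<in> E \<and> x = c v \<and> y = c p \<and> \<not> (v \<in> B \<and> p \<in> B))"
proof
  assume "(x, y) \<in> contracted"
  then obtain v p where "(v, p) \<in> E" "x = c v" "y = c p" "c v \<noteq> c p"
    unfolding contracted_def by auto
  moreover from this have "\<not> (v \<in> B \<and> p \<in> B)"
    using edges_in collapse_iff by (metis B_subset subsetD)
  ultimately show "\<exists>v p. (v, p) \<in> E \<and> x = c v \<and> y = c p \<and> \<not> (v \<in> B \<and> p \<in> B)"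
    by blast
next
  assume "\<exists>v p. (v, p) \<in> E \<and> x = c v \<and> y = c p \<and> \<not> (v \<in> B \<and> p \<in> B)"
  then obtain v p where vp: "(v, p) \<in> E" "x = c v" "y = c p" "\<not> (v \<in> B \<and> p \<in> B)"
    by blast
  then have "v \<in> V" "p \<in> V" "v \<noteq> p"
    using edges_in irreflexive by auto
  then have "c v \<noteq> c p"
    using vp collapse_eq[of v p] collapse_eq[of p v] by auto
  then show "(x, y) \<in> contracted"
    using vp unfolding contracted_def by force
qed

lemma contractedI:
  "(v, p) \<in> E \<Longrightarrow> \<not> (v \<in> B \<and> p \<in> B) \<Longrightarrow> (c v, c p) \<in> contracted"
  using contracted_iff by blast

lemma contracted_from_outside:
  assumes "(c v, y) \<in> contracted" "v \<in> V" "v \<notin> B"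
  shows "\<exists>p. (v, p) \<in> E \<and> y = c p"
  using assms contracted_iff collapse_eq[of v] edges_in by blast

lemma contracted_from_block:
  assumes "(b, y) \<in> contracted"
  shows "\<exists>p. (t, p) \<in> E \<and> p \<notin> B \<and> y = c p"
proof -
  obtain v p where vp: "(v, p) \<in> E" "b = c v" "y = c p" "\<not> (v \<in> B \<and> p \<in> B)"
    using assms contracted_iff by blast
  then have "v \<in> B"
    using collapse_iff edges_in by blast
  then show ?thesis
    using vp exit_from_root by blast
qed

lemma collapse_t: "c t = b"
  using t_in B_subset collapse_iff by blast

lemma root_in_block:
  assumes "\<And>p. (r, p) \<notin> E" "r \<in> B"
  shows "r = t"
proof (rule ccontr)
  assume "r \<noteq> t"
  then show False
    using arborescence_parent[OF subtree \<open>r \<in> B\<close>] assms by blast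
qed

text \<open>The parent of the contracted vertex is the parent of \<open>t\<close>, since no other vertex of \<open>B\<close> has an
  edge leading out of \<open>B\<close>.\<close>

lemma contracted_arborescence:
  assumes tree: "arborescence V E r"
  shows "arborescence (c ` V) contracted (c r)"
  unfolding arborescence_def
proof (intro conjI ballI allI)
  note rV = arborescence_root_in[OF tree] and no = arborescence_no_parent[OF tree]
  show "contracted \<subseteq> c ` V \<times> c ` V" "c r \<in> c ` V"
    using edges_in rV unfolding contracted_def by auto
  show "(c r, p) \<notin> contracted" for p
  proof (cases "r \<in> B")
    case True
    then show ?thesis
      using contracted_from_block[of p] root_in_block[OF no] collapse_t no by auto
  next
    case False
    then show ?thesis
      using contracted_from_outside[of r p] rV no by auto
  qed
  fix x
  show "\<exists>!p. (x, p) \<in> contracted" if x: "x \<in> c ` V - {c r}"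
  proof -
    \<comment> \<open>The vertex \<open>v\<close> over \<open>x\<close> through which the path to the root leaves.\<close>
    obtain v where v: "v \<in> V" "x = c v" "v = t \<or> v \<notin> B"
      using x collapse_t collapse_iff B_subset t_in by (metis DiffD1 imageE subsetD)
    then have "v \<noteq> r"
      using x by auto
    then obtain p where p: "(v, p) \<in> E"
      using arborescence_parent[OF tree] v by blast
    have nB: "\<not> (v \<in> B \<and> p \<in> B)"
      using v no_edge_t p by auto
    show ?thesis
    proof (intro ex1I)
      show "(x, c p) \<in> contracted"
        using contractedI[OF p nB] v by simp
      show "q = c p" if q: "(x, q) \<in> contracted" for q
      proof (cases "v \<in> B")
        case True
        then show ?thesis
          using q contracted_from_block[of q] v collapse_t functional p by auto
      next
        case False
        then show ?thesis
          using q contracted_from_outside[of v q] v functional p by auto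
      qed
    qed
  qed
  show "(x, c r) \<in> contracted\<^sup>*" if "x \<in> c ` V"
  proof -
    obtain v where v: "v \<in> V" "x = c v"
      using \<open>x \<in> c ` V\<close> by auto
    have "(v, r) \<in> E\<^sup>*"
      using arborescence_reaches[OF tree] v by auto
    then have "(c v, c r) \<in> contracted\<^sup>*"
    proof induction
      case (step y z)
      then have "(c y, c z) \<in> contracted\<^sup>="
        unfolding contracted_def by force
      with step.IH show ?case
        by auto
    qed auto
    then show ?thesis
      using v by simp
  qed
qed

text \<open>
  Conversely, a path to the root in the contraction lifts: inside \<open>B\<close> one first climbs to \<open>t\<close>, the
  only vertex of \<open>B\<close> from which an edge can leave \<open>B\<close>.
\<close>

lemma arborescence_if_contracted:
  assumes quot: "arborescence (c ` V) contracted r'"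
  shows "\<exists>r. arborescence V E r"
proof -
  obtain r0 where r0: "r0 \<in> V" "r' = c r0"
    using arborescence_root_in[OF quot] by blast
  define r where "r = (if r0 \<in> B then t else r0)"
  have rV: "r \<in> V" and r': "r' = c r" and r: "r = t \<or> r \<notin> B"
    using r0 t_in B_subset collapse_iff[of r0] collapse_t by (auto simp: r_def)
  note no' = arborescence_no_parent[OF quot]
  have to_t: "(v, t) \<in> E\<^sup>*" if "v \<in> B" for v
  proof -
    have "(v, t) \<in> (E \<inter> B \<times> B)\<^sup>*"
      using arborescence_reaches[OF subtree that] .
    then show ?thesis
      by (rule rtrancl_mono[THEN subsetD, rotated]) auto
  qed
  have "arborescence V E r"
    unfolding arborescence_def
  proof (intro conjI ballI allI)
    show "E \<subseteq> V \<times> V"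
      by (rule edges_in)
    show "r \<in> V"
      by (rule rV)
    show "(r, p) \<notin> E" for p
    proof
      assume e: "(r, p) \<in> E"
      then have "\<not> (r \<in> B \<and> p \<in> B)"
        using r no_edge_t by auto
      then show False
        using contractedI[OF e] no' r' by auto
    qed
  next
    fix v assume v: "v \<in> V - {r}"
    have "\<exists>p. (v, p) \<in> E"
    proof (cases "v \<in> B \<and> v \<noteq> t")
      case True
      then show ?thesis
        using arborescence_parent[OF subtree, of v] by blast
    next
      case False
      have "c v \<noteq> r'"
      proof
        assume eq: "c v = r'"
        show False
        proof (cases "v \<in> B")
          case True
          then have "r \<in> B"
            using eq r' collapse_iff[of v] collapse_iff[of r] v rV by auto
          then show False
            using r v False True by auto
        next
          case False
          then show False
            using eq r' collapse_eq[of v r] v rV by auto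
        qed
      qed
      then obtain q where "(c v, q) \<in> contracted"
        using arborescence_parent[OF quot] v by blast
      then show ?thesis
        using False contracted_from_block[of q] contracted_from_outside[of v q] collapse_t v by auto
    qed
    then show "\<exists>!p. (v, p) \<in> E"
      using functional by blast
  next
    fix v assume v: "v \<in> V"
    have "(c v, r') \<in> contracted\<^sup>*"
      using arborescence_reaches[OF quot] v by blast
    then have "\<forall>w\<in>V. c w = c v \<longrightarrow> (w, r) \<in> E\<^sup>*"
    proof (induction rule: converse_rtrancl_induct)
      case base
      show ?case
      proof (intro ballI impI)
        fix w assume w: "w \<in> V" "c w = r'"
        show "(w, r) \<in> E\<^sup>*"
        proof (cases "w \<in> B")
          case True
          then have "r \<in> B"
            using w r' collapse_iff rV by metis
          then show ?thesis
            using to_t[OF True] r by auto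
        next
          case False
          then show ?thesis
            using collapse_eq[of w r] w r' rV by auto
        qed
      qed
    next
      case (step x y)
      show ?case
      proof (intro ballI impI)
        fix w assume w: "w \<in> V" "c w = x"
        show "(w, r) \<in> E\<^sup>*"
        proof (cases "w \<in> B")
          case True
          then have "x = b"
            using w collapse_iff by auto
          then obtain p where p: "(t, p) \<in> E" "y = c p"
            using step.hyps contracted_from_block by blast
          then have "(p, r) \<in> E\<^sup>*"
            using step.IH edges_in by blast
          then show ?thesis
            using to_t[OF True] p by (meson converse_rtrancl_into_rtrancl rtrancl_trans)
        next
          case False
          then obtain p where p: "(w, p) \<in> E" "y = c p"
            using step.hyps contracted_from_outside w by blast
          then have "(p, r) \<in> E\<^sup>*"
            using step.IH edges_in by blast
          then show ?thesis
            using p by (meson converse_rtrancl_into_rtrancl)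
        qed
      qed
    qed
    then show "(v, r) \<in> E\<^sup>*"
      using v by blast
  qed
  then show ?thesis ..
qed

text \<open>
  Contracting \<open>B\<close> and counting the depth inside \<open>B\<close> separately loses exactly the part of a path which
  runs inside \<open>B\<close> after entering \<open>B\<close> from below at a vertex other than \<open>t\<close>.
\<close>

definition split_depth :: "'a \<Rightarrow> 'a \<Rightarrow> nat" where
  "split_depth r v =
     depth contracted (c r) (c v) + (if v \<in> B then depth (E \<inter> B \<times> B) t v else 0)"

lemma split_depth_root:
  assumes tree: "arborescence V E r"
  shows "split_depth r r = 0"
proof -
  have "r \<in> B \<Longrightarrow> r = t"
    using root_in_block arborescence_no_parent[OF tree] by blast
  then show ?thesis
    using depth_root[OF contracted_arborescence[OF tree]] depth_root[OF subtree]
    by (auto simp: split_depth_def)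
qed

lemma split_depth_edge:
  assumes tree: "arborescence V E r" and e: "(v, p) \<in> E"
  shows "split_depth r v \<le> Suc (split_depth r p)"
    and "(v \<notin> B \<Longrightarrow> p \<in> B \<Longrightarrow> p = t) \<Longrightarrow> split_depth r v = Suc (split_depth r p)"
proof -
  note ctree = contracted_arborescence[OF tree]
  have in_block: "split_depth r v = Suc (split_depth r p)" if "v \<in> B" "p \<in> B"
  proof -
    have "c v = c p"
      using that B_subset collapse_iff by (metis subsetD)
    moreover have "(v, p) \<in> E \<inter> B \<times> B"
      using that e by auto
    ultimately show ?thesis
      using depth_edge[OF subtree, of v p] that by (simp add: split_depth_def)
  qed
  have step: "depth contracted (c r) (c v) = Suc (depth contracted (c r) (c p))"
    if "\<not> (v \<in> B \<and> p \<in> B)"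
    by (rule depth_edge[OF ctree contractedI[OF e that]])
  have leave: "v = t" if "v \<in> B" "p \<notin> B"
    using exit_from_root e that by blast
  show "split_depth r v \<le> Suc (split_depth r p)"
    using in_block step leave depth_root[OF subtree] by (auto simp: split_depth_def)
  show "split_depth r v = Suc (split_depth r p)" if "v \<notin> B \<Longrightarrow> p \<in> B \<Longrightarrow> p = t"
    using in_block step leave depth_root[OF subtree] that t_in by (auto simp: split_depth_def)
qed

lemma split_depth_le:
  assumes "arborescence V E r" "v \<in> V"
  shows "split_depth r v \<le> depth E r v"
  by (rule depth_lower_bound[OF assms split_depth_root split_depth_edge(1)]) (use assms in auto)

lemma split_depth_eq:
  assumes "arborescence V E r" "v \<in> V"
    and "\<And>v p. (v, p) \<in> E \<Longrightarrow> v \<notin> B \<Longrightarrow> p \<in> B \<Longrightarrow> p = t"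
  shows "split_depth r v = depth E r v"
  by (rule depth_determined[OF assms(1,2) split_depth_root split_depth_edge(2)])
    (use assms in auto)

end


section \<open>Weighted trees under maps of labels\<close>

lemma is_wtree_iff:
  "is_wtree T \<longleftrightarrow>
     (\<forall>v\<in>verts T. 1 \<le> weight T v) \<and> (\<exists>r. arborescence (verts T) (edges T) r)"
  unfolding is_wtree_def arborescence_def by blast

lemma tree_root_eq:
  assumes "arborescence (verts T) (edges T) r"
  shows "tree_root T = r"
  unfolding tree_root_def
proof (rule the_equality)
  show "r \<in> verts T \<and> (\<forall>p. (r, p) \<notin> edges T)"
    using arborescence_root_in[OF assms] arborescence_no_parent[OF assms] by blast
  show "r' = r" if "r' \<in> verts T \<and> (\<forall>p. (r', p) \<notin> edges T)" for r'
    using that arborescence_parent[OF assms, of r'] by blast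
qed

lemma is_wtree_arborescence:
  assumes "is_wtree T"
  shows "arborescence (verts T) (edges T) (tree_root T)"
  using assms tree_root_eq unfolding is_wtree_iff by blast

lemma is_wtree_edges: "is_wtree T \<Longrightarrow> edges T \<subseteq> verts T \<times> verts T"
  by (rule arborescence_edges[OF is_wtree_arborescence])

lemma is_wtree_irrefl: "is_wtree T \<Longrightarrow> (v, v) \<notin> edges T"
  by (rule arborescence_irrefl[OF is_wtree_arborescence])

lemma is_wtree_weight: "is_wtree T \<Longrightarrow> v \<in> verts T \<Longrightarrow> 1 \<le> weight T v"
  unfolding is_wtree_iff by blast

lemma height_eq_depth:
  assumes "arborescence (verts T) (edges T) r"
  shows "height T v = depth (edges T) r v"
  by (simp add: height_def depth_def tree_root_eq[OF assms])

lemma wtree_eqI: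
  assumes "length (weights T) = length (weights T')"
    and "\<And>v. v \<in> verts T' \<Longrightarrow> weight T v = weight T' v" and "edges T = edges T'"
  shows "T = T'"
proof -
  have "weights T ! k = weights T' ! k" if "k < length (weights T')" for k
    using assms(2)[of "Suc k"] that by (simp add: weight_def verts_def)
  then have "weights T = weights T'"
    using assms(1) by (simp add: nth_equalityI)
  then show ?thesis
    using assms(3) by (rule wtree.expand[OF conjI])
qed

text \<open>
  Contraction of a block of vertices and relabelling are both direct images of a tree under a map
  of labels: weights are added up along the fibres, and edges inside a fibre disappear. Passing to
  a subtree is an inverse image. The identities between these operations thus reduce to identities
  between maps of labels.
\<close>

definition push_tree :: "nat \<Rightarrow> (nat \<Rightarrow> nat) \<Rightarrow> wtree \<Rightarrow> wtree" where
  "push_tree n c U =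
     WTree (map (\<lambda>u. \<Sum>v | v \<in> verts U \<and> c v = u. weight U v) [1..<n + 1])
       (map_prod c c ` edges U - Id)"

definition pull_tree :: "nat \<Rightarrow> (nat \<Rightarrow> nat) \<Rightarrow> wtree \<Rightarrow> wtree" where
  "pull_tree m g U =
     WTree (map (\<lambda>x. weight U (g x)) [1..<m + 1])
       {(x, y). x \<in> {1..m} \<and> y \<in> {1..m} \<and> (g x, g y) \<in> edges U}"

lemma nth_map_upt_Suc: "u \<in> {1..n} \<Longrightarrow> map f [1..<n + 1] ! (u - 1) = f u"
  by (subst nth_map) (auto simp del: upt_Suc)

lemma length_push_tree [simp]: "length (weights (push_tree n c U)) = n"
  by (simp add: push_tree_def)

lemma verts_push_tree [simp]: "verts (push_tree n c U) = {1..n}"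
  by (simp add: verts_def)

lemma edges_push_tree: "edges (push_tree n c U) = map_prod c c ` edges U - Id"
  by (simp add: push_tree_def)

lemma weight_push_tree:
  "u \<in> {1..n} \<Longrightarrow> weight (push_tree n c U) u = (\<Sum>v | v \<in> verts U \<and> c v = u. weight U v)"
  by (simp only: weight_def push_tree_def wtree.sel nth_map_upt_Suc)

lemma length_pull_tree [simp]: "length (weights (pull_tree m g U)) = m"
  by (simp add: pull_tree_def)

lemma verts_pull_tree [simp]: "verts (pull_tree m g U) = {1..m}"
  by (simp add: verts_def)

lemma edges_pull_tree:
  "edges (pull_tree m g U) = {(x, y). x \<in> {1..m} \<and> y \<in> {1..m} \<and> (g x, g y) \<in> edges U}"
  by (simp add: pull_tree_def)

lemma weight_pull_tree: "x \<in> {1..m} \<Longrightarrow> weight (pull_tree m g U) x = weight U (g x)"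
  by (simp only: weight_def pull_tree_def wtree.sel nth_map_upt_Suc)

lemma finite_verts [simp]: "finite (verts T)"
  by (simp add: verts_def)

lemma push_push:
  assumes "c ` verts U \<subseteq> {1..n}"
  shows "push_tree n' d (push_tree n c U) = push_tree n' (d \<circ> c) U"
proof (rule wtree_eqI)
  fix u assume "u \<in> verts (push_tree n' (d \<circ> c) U)"
  then have u: "u \<in> {1..n'}"
    by simp
  have "(\<Sum>w | w \<in> {1..n} \<and> d w = u. weight (push_tree n c U) w) =
      (\<Sum>w | w \<in> {1..n} \<and> d w = u. \<Sum>v | v \<in> {v \<in> verts U. d (c v) = u} \<and> c v = w. weight U v)"
    by (intro sum.cong refl) (auto simp: weight_push_tree intro: sum.cong)
  also have "\<dots> = (\<Sum>v | v \<in> verts U \<and> d (c v) = u. weight U v)"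
    by (rule sum.group) (use assms in auto)
  finally show "weight (push_tree n' d (push_tree n c U)) u = weight (push_tree n' (d \<circ> c) U) u"
    using u by (simp add: weight_push_tree)
next
  show "edges (push_tree n' d (push_tree n c U)) = edges (push_tree n' (d \<circ> c) U)"
    unfolding edges_push_tree by force
qed simp

lemma push_cong:
  assumes "edges U \<subseteq> verts U \<times> verts U" and "\<And>v. v \<in> verts U \<Longrightarrow> c v = c' v"
  shows "push_tree n c U = push_tree n c' U"
proof (rule wtree_eqI)
  fix u assume "u \<in> verts (push_tree n c' U)"
  then show "weight (push_tree n c U) u = weight (push_tree n c' U) u"
    by (auto simp: weight_push_tree assms(2) intro!: sum.cong)
next
  have "map_prod c c ` edges U = map_prod c' c' ` edges U"
    by (rule image_cong) (use assms in auto)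
  then show "edges (push_tree n c U) = edges (push_tree n c' U)"
    unfolding edges_push_tree by simp
qed simp

lemma push_id:
  assumes "\<And>v. (v, v) \<notin> edges U" and "length (weights U) = n"
  shows "push_tree n id U = U"
proof (rule wtree_eqI)
  fix u assume u: "u \<in> verts U"
  then have "{v. v \<in> verts U \<and> id v = u} = {u}"
    by auto
  then show "weight (push_tree n id U) u = weight U u"
    using u assms(2) by (simp add: weight_push_tree verts_def)
qed (use assms in \<open>auto simp: edges_push_tree prod.map_id0\<close>)

lemma pull_pull:
  assumes "g' ` {1..k} \<subseteq> {1..m}"
  shows "pull_tree k g' (pull_tree m g U) = pull_tree k (g \<circ> g') U"
proof (rule wtree_eqI)
  fix u assume "u \<in> verts (pull_tree k (g \<circ> g') U)"
  then have "u \<in> {1..k}"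
    by simp
  moreover from this have "g' u \<in> {1..m}"
    using assms by blast
  ultimately show "weight (pull_tree k g' (pull_tree m g U)) u = weight (pull_tree k (g \<circ> g') U) u"
    by (simp add: weight_pull_tree)
next
  show "edges (pull_tree k g' (pull_tree m g U)) = edges (pull_tree k (g \<circ> g') U)"
    using assms by (auto simp: edges_pull_tree image_subset_iff)
qed simp

lemma pull_cong:
  assumes "\<And>x. x \<in> {1..m} \<Longrightarrow> g x = g' x"
  shows "pull_tree m g U = pull_tree m g' U"
proof (rule wtree_eqI)
  show "edges (pull_tree m g U) = edges (pull_tree m g' U)"
    using assms by (auto simp: edges_pull_tree)
qed (use assms in \<open>auto simp: weight_pull_tree\<close>)

lemma pull_id:
  assumes "edges U \<subseteq> verts U \<times> verts U" and "length (weights U) = n"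
  shows "pull_tree n id U = U"
  by (rule wtree_eqI) (use assms in \<open>auto simp: edges_pull_tree weight_pull_tree verts_def\<close>)

text \<open>Base change: the hypotheses say that \<open>g'\<close> and \<open>c'\<close> form the fibre product of \<open>c\<close> and \<open>g\<close>.\<close>

lemma pull_push:
  assumes edges: "edges U \<subseteq> verts U \<times> verts U"
    and g: "inj_on g {1..m}" "g ` {1..m} \<subseteq> {1..n}"
    and g': "inj_on g' {1..k}" "g' ` {1..k} \<subseteq> verts U"
    and c': "\<And>y. y \<in> {1..k} \<Longrightarrow> c' y \<in> {1..m}"
    and square: "\<And>y. y \<in> {1..k} \<Longrightarrow> c (g' y) = g (c' y)"
    and cover: "\<And>v. v \<in> verts U \<Longrightarrow> c v \<in> g ` {1..m} \<Longrightarrow> v \<in> g' ` {1..k}"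
  shows "pull_tree m g (push_tree n c U) = push_tree m c' (pull_tree k g' U)"
proof (rule wtree_eqI)
  fix x assume "x \<in> verts (push_tree m c' (pull_tree k g' U))"
  then have x: "x \<in> {1..m}"
    by simp
  then have gx: "g x \<in> {1..n}"
    using g by blast
  have fibre: "{v. v \<in> verts U \<and> c v = g x} = g' ` {y \<in> {1..k}. c' y = x}" (is "?L = ?R")
  proof
    show "?R \<subseteq> ?L"
      using square g' by auto
    show "?L \<subseteq> ?R"
    proof
      fix v assume v: "v \<in> ?L"
      then obtain y where y: "y \<in> {1..k}" "v = g' y"
        using cover[of v] x by auto
      then have "g (c' y) = g x" "c' y \<in> {1..m}"
        using square v c' by auto
      then have "c' y = x"
        using g x by (auto dest: inj_onD)
      then show "v \<in> ?R"
        using y by auto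
    qed
  qed
  have "inj_on g' {y \<in> {1..k}. c' y = x}"
    by (rule inj_on_subset[OF g'(1)]) auto
  then have "(\<Sum>v | v \<in> verts U \<and> c v = g x. weight U v) =
      (\<Sum>y | y \<in> {1..k} \<and> c' y = x. weight U (g' y))"
    unfolding fibre by (simp add: sum.reindex)
  also have "\<dots> = (\<Sum>y | y \<in> {1..k} \<and> c' y = x. weight (pull_tree k g' U) y)"
    by (intro sum.cong refl) (auto simp: weight_pull_tree)
  finally show "weight (pull_tree m g (push_tree n c U)) x =
      weight (push_tree m c' (pull_tree k g' U)) x"
    using x gx by (simp add: weight_push_tree weight_pull_tree)
next
  show "edges (pull_tree m g (push_tree n c U)) = edges (push_tree m c' (pull_tree k g' U))"
    (is "?L = ?R")
  proof (intro equalityI subrelI)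
    fix x y assume "(x, y) \<in> ?L"
    then have xy: "x \<in> {1..m}" "y \<in> {1..m}" "(g x, g y) \<in> map_prod c c ` edges U" "g x \<noteq> g y"
      by (auto simp: edges_pull_tree edges_push_tree)
    then obtain v w where vw: "(v, w) \<in> edges U" "c v = g x" "c w = g y"
      by auto
    then have "v \<in> verts U" "w \<in> verts U"
      using edges by auto
    then obtain a b' where ab: "a \<in> {1..k}" "v = g' a" "b' \<in> {1..k}" "w = g' b'"
      using cover[of v] cover[of w] vw xy by auto
    then have "g (c' a) = g x" "g (c' b') = g y" "c' a \<in> {1..m}" "c' b' \<in> {1..m}"
      using square[of a] square[of b'] vw c' by auto
    then have "c' a = x" "c' b' = y"
      using xy by (auto intro: inj_onD[OF g(1)])
    moreover have "(a, b') \<in> edges (pull_tree k g' U)"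
      using ab vw by (simp add: edges_pull_tree)
    ultimately show "(x, y) \<in> ?R"
      using xy by (force simp: edges_push_tree)
  next
    fix x y assume "(x, y) \<in> ?R"
    then obtain a b' where ab: "(a, b') \<in> edges (pull_tree k g' U)" "x = c' a" "y = c' b'" "x \<noteq> y"
      by (auto simp: edges_push_tree)
    then have *: "a \<in> {1..k}" "b' \<in> {1..k}" "(g' a, g' b') \<in> edges U"
      by (auto simp: edges_pull_tree)
    then have xy: "x \<in> {1..m}" "y \<in> {1..m}"
      using ab c' by auto
    then have "g x \<noteq> g y"
      using ab g by (auto dest: inj_onD)
    moreover have "(g x, g y) = map_prod c c (g' a, g' b')"
      using square * ab by simp
    ultimately show "(x, y) \<in> ?L"
      using xy * by (auto simp: edges_pull_tree edges_push_tree intro!: image_eqI)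
  qed
qed simp

text \<open>A bijection of labels has singleton fibres and loses no edge of a loop-free graph.\<close>

lemma relabel_eq_push:
  assumes "\<sigma> permutes {1..n}" and n: "length (weights T) = n" and "\<And>v. (v, v) \<notin> edges T"
  shows "relabel T \<sigma> = push_tree n (inv \<sigma>) T"
proof (rule wtree_eqI)
  show "length (weights (relabel T \<sigma>)) = length (weights (push_tree n (inv \<sigma>) T))"
    using n by (simp add: relabel_def perm_degree_def)
next
  fix u assume "u \<in> verts (push_tree n (inv \<sigma>) T)"
  then have u: "u \<in> {1..n}"
    by simp
  then have "\<sigma> u \<in> verts T"
    using permutes_in_image[OF assms(1)] n by (simp add: verts_def)
  then have "{v. v \<in> verts T \<and> inv \<sigma> v = u} = {\<sigma> u}"
    using permutes_inverses[OF assms(1)] by auto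
  then show "weight (relabel T \<sigma>) u = weight (push_tree n (inv \<sigma>) T) u"
    using u by (simp add: weight_push_tree)
      (use u n in \<open>simp only: weight_def relabel_def perm_degree_def wtree.sel nth_map_upt_Suc\<close>)
next
  have "inj (inv \<sigma>)"
    by (rule permutes_inj[OF permutes_inv[OF assms(1)]])
  then show "edges (relabel T \<sigma>) = edges (push_tree n (inv \<sigma>) T)"
    using assms(3) by (auto simp: relabel_def edges_push_tree dest: injD)
qed

lemma push_perm_is_wtree:
  assumes "is_wtree T" "length (weights T) = n" "\<sigma> permutes {1..n}"
  shows "is_wtree (push_tree n \<sigma> T)"
    and "v \<in> verts T \<Longrightarrow> height (push_tree n \<sigma> T) (\<sigma> v) = height T v"
    and "v \<in> verts T \<Longrightarrow> weight (push_tree n \<sigma> T) (\<sigma> v) = weight T v"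
proof -
  have V: "verts T = {1..n}"
    using assms(2) by (simp add: verts_def)
  have inj: "inj \<sigma>"
    using assms(3) by (rule permutes_inj)
  have E: "edges (push_tree n \<sigma> T) = map_prod \<sigma> \<sigma> ` edges T"
    using is_wtree_irrefl[OF assms(1)] inj by (auto simp: edges_push_tree dest: injD)
  have injV: "inj_on \<sigma> (verts T)"
    using inj by (rule inj_on_subset) simp
  have im: "\<sigma> ` verts T = verts (push_tree n \<sigma> T)"
    using permutes_image[OF assms(3)] V by simp
  note tree = is_wtree_arborescence[OF assms(1)]
  note tree' = arborescence_image[OF tree injV, unfolded im E[symmetric]]
  show "height (push_tree n \<sigma> T) (\<sigma> v) = height T v" if "v \<in> verts T"
    using depth_image[OF tree injV that] unfolding E[symmetric]
    by (simp add: height_eq_depth[OF tree'] height_eq_depth[OF tree])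
  show wt: "weight (push_tree n \<sigma> T) (\<sigma> v) = weight T v" if "v \<in> verts T" for v
  proof -
    have "\<sigma> v \<in> {1..n}" "{w. w \<in> verts T \<and> \<sigma> w = \<sigma> v} = {v}"
      using that im inj by (auto dest: injD)
    then show ?thesis
      by (simp add: weight_push_tree)
  qed
  have "1 \<le> weight (push_tree n \<sigma> T) u" if "u \<in> verts (push_tree n \<sigma> T)" for u
    using that wt is_wtree_weight[OF assms(1)] unfolding im[symmetric] by auto
  then show "is_wtree (push_tree n \<sigma> T)"
    using tree' unfolding is_wtree_iff by blast
qed

lemma push_perm_energy:
  assumes "is_wtree T" "length (weights T) = n" "\<sigma> permutes {1..n}"
  shows "energy (push_tree n \<sigma> T) = energy T"
proof -
  have V: "verts T = {1..n}"
    using assms(2) by (simp add: verts_def)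
  have "energy (push_tree n \<sigma> T) =
      (\<Sum>v\<in>\<sigma> ` verts T. weight (push_tree n \<sigma> T) v * height (push_tree n \<sigma> T) v)"
    using permutes_image[OF assms(3)] V by (simp add: energy_def)
  also have "\<dots> = (\<Sum>v\<in>verts T. weight (push_tree n \<sigma> T) (\<sigma> v) * height (push_tree n \<sigma> T) (\<sigma> v))"
    using permutes_inj_on[OF assms(3)] by (simp add: sum.reindex)
  also have "\<dots> = energy T"
    unfolding energy_def by (intro sum.cong refl) (simp add: push_perm_is_wtree[OF assms])
  finally show ?thesis .
qed

lemma is_wtree_relabel:
  assumes "is_wtree T" "length (weights T) = n" "\<sigma> permutes {1..n}"
  shows "is_wtree (relabel T \<sigma>)" "length (weights (relabel T \<sigma>)) = n"
    and "energy (relabel T \<sigma>) = energy T"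
proof -
  have eq: "relabel T \<sigma> = push_tree n (inv \<sigma>) T"
    by (rule relabel_eq_push[OF assms(3,2) is_wtree_irrefl[OF assms(1)]])
  show "is_wtree (relabel T \<sigma>)" "length (weights (relabel T \<sigma>)) = n" "energy (relabel T \<sigma>) = energy T"
    unfolding eq using push_perm_is_wtree(1)[OF assms(1,2) permutes_inv[OF assms(3)]]
      push_perm_energy[OF assms(1,2) permutes_inv[OF assms(3)]] by simp_all
qed

lemma relabel_relabel:
  assumes "is_wtree T" "length (weights T) = n" "\<sigma> permutes {1..n}" "\<tau> permutes {1..n}"
  shows "relabel (relabel T \<sigma>) \<tau> = relabel T (\<sigma> \<circ> \<tau>)"
proof -
  note T' = is_wtree_relabel[OF assms(1-3)]
  have "relabel (relabel T \<sigma>) \<tau> = push_tree n (inv \<tau>) (relabel T \<sigma>)"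
    by (rule relabel_eq_push[OF assms(4) T'(2) is_wtree_irrefl[OF T'(1)]])
  also have "\<dots> = push_tree n (inv \<tau>) (push_tree n (inv \<sigma>) T)"
    by (simp add: relabel_eq_push[OF assms(3,2) is_wtree_irrefl[OF assms(1)]])
  also have "\<dots> = push_tree n (inv \<tau> \<circ> inv \<sigma>) T"
    by (rule push_push) (use permutes_image[OF permutes_inv[OF assms(3)]] assms(2) in \<open>simp add: verts_def\<close>)
  also have "inv \<tau> \<circ> inv \<sigma> = inv (\<sigma> \<circ> \<tau>)"
    by (rule o_inv_distrib[symmetric]) (use assms(3,4) permutes_bij in auto)
  also have "push_tree n (inv (\<sigma> \<circ> \<tau>)) T = relabel T (\<sigma> \<circ> \<tau>)"
    by (rule relabel_eq_push[OF permutes_compose[OF assms(4,3)] assms(2) is_wtree_irrefl[OF assms(1)], symmetric])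
  finally show ?thesis .
qed

lemma relabel_id:
  assumes "is_wtree T"
  shows "relabel T id = T"
  using relabel_eq_push[OF permutes_id refl is_wtree_irrefl[OF assms]]
    push_id[OF is_wtree_irrefl[OF assms] refl] by simp

lemma relabel_inv:
  assumes "is_wtree T" "length (weights T) = n" "\<sigma> permutes {1..n}"
  shows "relabel (relabel T \<sigma>) (inv \<sigma>) = T" "relabel (relabel T (inv \<sigma>)) \<sigma> = T"
  using relabel_relabel[OF assms permutes_inv[OF assms(3)]]
    relabel_relabel[OF assms(1,2) permutes_inv[OF assms(3)] assms(3)]
    permutes_inv_o[OF assms(3)] relabel_id[OF assms(1)] by simp_all

lemma relabel_in_wtrees: "T \<in> wtrees n \<Longrightarrow> \<sigma> permutes {1..n} \<Longrightarrow> relabel T \<sigma> \<in> wtrees n"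
  using is_wtree_relabel by (simp add: wtrees_def)

lemma is_wtree_relabel_iff:
  assumes "\<tau> permutes {1..m}" "length (weights Z) = m" "\<And>v. (v, v) \<notin> edges Z"
  shows "is_wtree (relabel Z \<tau>) \<longleftrightarrow> is_wtree Z"
proof
  assume tree: "is_wtree (relabel Z \<tau>)"
  have "push_tree m \<tau> (relabel Z \<tau>) = push_tree m (\<tau> \<circ> inv \<tau>) Z"
    unfolding relabel_eq_push[OF assms]
    by (rule push_push) (use permutes_image[OF permutes_inv[OF assms(1)]] assms(2) in \<open>simp add: verts_def\<close>)
  also have "\<dots> = Z"
    unfolding permutes_inv_o[OF assms(1)] by (rule push_id[OF assms(3,2)])
  finally show "is_wtree Z"
    using push_perm_is_wtree(1)[OF tree _ assms(1)] by (simp add: relabel_eq_push[OF assms])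
qed (use is_wtree_relabel assms in blast)


section \<open>Blocks of labels\<close>

text \<open>The labels after the block \<open>{i..i+m-1}\<close> has been contracted to the single label \<open>i\<close>.\<close>

definition collapse :: "nat \<Rightarrow> nat \<Rightarrow> nat \<Rightarrow> nat" where
  "collapse i m x = (if x < i then x else if x < i + m then i else x + 1 - m)"

definition contract_block :: "nat \<Rightarrow> nat \<Rightarrow> wtree \<Rightarrow> wtree" where
  "contract_block i m U = push_tree (length (weights U) + 1 - m) (collapse i m) U"

definition restrict_block :: "nat \<Rightarrow> nat \<Rightarrow> wtree \<Rightarrow> wtree" where
  "restrict_block i m U = pull_tree m (inner_label i) U"

lemma length_contract_block [simp]:
  "length (weights (contract_block i m U)) = length (weights U) + 1 - m"
  by (simp add: contract_block_def)

lemma length_restrict_block [simp]: "length (weights (restrict_block i m U)) = m"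
  by (simp add: restrict_block_def)

lemma inj_on_inner_label: "1 \<le> i \<Longrightarrow> inj_on (inner_label i) A"
  by (auto simp: inner_label_def inj_on_def)

lemma image_inner_label:
  assumes "1 \<le> i"
  shows "inner_label i ` {1..m} = {i..<i + m}"
proof -
  have "x \<in> inner_label i ` {1..m}" if "x \<in> {i..<i + m}" for x
    using that assms by (intro image_eqI[of _ _ "x + 1 - i"]) (auto simp: inner_label_def)
  then show ?thesis
    using assms by (auto simp: inner_label_def)
qed

lemma image_collapse:
  assumes "1 \<le> i" "i \<le> n" "1 \<le> m"
  shows "collapse i m ` {1..n + m - 1} = {1..n}"
proof -
  have "x \<in> collapse i m ` {1..n + m - 1}" if "x \<in> {1..n}" for x
    using that assms by (intro image_eqI[of _ _ "outer_label (i + 1) m x"])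
      (auto simp: outer_label_def collapse_def)
  moreover have "collapse i m x \<in> {1..n}" if "x \<in> {1..n + m - 1}" for x
    using that assms by (auto simp: collapse_def)
  ultimately show ?thesis
    by blast
qed

lemma collapse_eq_iff:
  "1 \<le> m \<Longrightarrow> collapse i m x = collapse i m y \<longleftrightarrow> x = y \<or> x \<in> {i..<i + m} \<and> y \<in> {i..<i + m}"
  by (auto simp: collapse_def)

lemma collapse_eq_block: "1 \<le> m \<Longrightarrow> collapse i m x = i \<longleftrightarrow> x \<in> {i..<i + m}"
  by (auto simp: collapse_def)

lemma collapse_outer: "1 \<le> m \<Longrightarrow> x \<noteq> i \<Longrightarrow> collapse i m (outer_label i m x) = x"
  by (auto simp: collapse_def outer_label_def)

lemma outer_collapse: "1 \<le> m \<Longrightarrow> x \<notin> {i..<i + m} \<Longrightarrow> outer_label i m (collapse i m x) = x"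
  by (auto simp: collapse_def outer_label_def)

lemma edges_restrict_block:
  assumes "1 \<le> i"
  shows "map_prod (inner_label i) (inner_label i) ` edges (restrict_block i m U) =
    edges U \<inter> {i..<i + m} \<times> {i..<i + m}" (is "?L = ?R")
proof (intro equalityI subrelI)
  fix x y assume "(x, y) \<in> ?L"
  then obtain a b where "(a, b) \<in> edges (restrict_block i m U)" "x = inner_label i a" "y = inner_label i b"
    by auto
  then show "(x, y) \<in> ?R"
    using image_inner_label[OF assms, of m] by (auto simp: restrict_block_def edges_pull_tree)
next
  fix x y assume xy: "(x, y) \<in> ?R"
  then have "x \<in> inner_label i ` {1..m}" "y \<in> inner_label i ` {1..m}"
    using image_inner_label[OF assms, of m] by auto
  then obtain a b where "a \<in> {1..m}" "b \<in> {1..m}" "x = inner_label i a" "y = inner_label i b"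
    by blast
  then show "(x, y) \<in> ?L"
    using xy by (force simp: restrict_block_def edges_pull_tree)
qed

text \<open>
  The local conditions on a tree. They are inherited by the restriction to any block, in contrast to
  the existence of a root which is reached from everywhere.
\<close>

definition parent_graph :: "wtree \<Rightarrow> bool" where
  "parent_graph U \<longleftrightarrow>
     (\<forall>v\<in>verts U. 1 \<le> weight U v) \<and> edges U \<subseteq> verts U \<times> verts U \<and>
     single_valued (edges U) \<and> irrefl (edges U)"

lemma is_wtree_parent_graph:
  assumes "is_wtree U"
  shows "parent_graph U"
  unfolding parent_graph_def
proof (intro conjI)
  show "single_valued (edges U)"
    using arborescence_parent_unique[OF is_wtree_arborescence[OF assms]] by (rule single_valuedI)
  show "irrefl (edges U)"
    using is_wtree_irrefl[OF assms] by (rule irreflI)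
qed (use is_wtree_weight[OF assms] is_wtree_edges[OF assms] in auto)

lemma parent_graph_restrict_block:
  assumes "parent_graph U" "1 \<le> i" "i + m \<le> length (weights U) + 1"
  shows "parent_graph (restrict_block i m U)"
proof -
  have "inner_label i x \<in> verts U" if "x \<in> {1..m}" for x
    using that assms(2,3) by (auto simp: inner_label_def verts_def)
  then have "1 \<le> weight (restrict_block i m U) x" if "x \<in> {1..m}" for x
    using that assms(1) by (simp add: restrict_block_def weight_pull_tree parent_graph_def)
  moreover have "single_valued (edges (restrict_block i m U))"
  proof (rule single_valuedI)
    fix x y z
    assume "(x, y) \<in> edges (restrict_block i m U)" "(x, z) \<in> edges (restrict_block i m U)"
    then have "inner_label i y = inner_label i z"
      using assms(1) by (auto simp: restrict_block_def edges_pull_tree parent_graph_def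
          dest: single_valuedD)
    then show "y = z"
      using inj_on_inner_label[OF assms(2), of UNIV] by (auto dest: injD)
  qed
  moreover have "irrefl (edges (restrict_block i m U))"
    using assms(1) by (auto simp: restrict_block_def edges_pull_tree parent_graph_def irrefl_def)
  moreover have "edges (restrict_block i m U) \<subseteq> {1..m} \<times> {1..m}"
    by (auto simp: restrict_block_def edges_pull_tree)
  ultimately show ?thesis
    by (simp add: parent_graph_def restrict_block_def)
qed

lemma subtree_contraction_block:
  assumes "1 \<le> i" "i \<le> n" "1 \<le> m" and len: "length (weights U) = n + m - 1"
    and U: "parent_graph U" and sub: "is_wtree (restrict_block i m U)"
  shows "subtree_contraction (verts U) {i..<i + m} (edges U) (collapse i m) i
      (inner_label i (tree_root (restrict_block i m U)))"
proof
  show "edges U \<subseteq> verts U \<times> verts U"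
    using U by (simp add: parent_graph_def)
  show "(v, p) \<in> edges U \<Longrightarrow> (v, q) \<in> edges U \<Longrightarrow> p = q" for v p q
    using U by (auto simp: parent_graph_def dest: single_valuedD)
  show "(v, v) \<notin> edges U" for v
    using U by (auto simp: parent_graph_def irrefl_def)
  show "{i..<i + m} \<subseteq> verts U"
    using assms by (auto simp: verts_def)
  show "arborescence {i..<i + m} (edges U \<inter> {i..<i + m} \<times> {i..<i + m})
      (inner_label i (tree_root (restrict_block i m U)))"
    using arborescence_image[OF is_wtree_arborescence[OF sub] inj_on_inner_label[OF assms(1)]]
    unfolding edges_restrict_block[OF assms(1)]
    by (simp add: restrict_block_def image_inner_label[OF assms(1), simplified])
  show "collapse i m v = i \<longleftrightarrow> v \<in> {i..<i + m}" for v
    by (rule collapse_eq_block[OF assms(3)])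
  show "inj_on (collapse i m) (verts U - {i..<i + m})"
    using collapse_eq_iff[OF assms(3)] by (auto simp: inj_on_def)
qed

lemma edges_contract_block: "edges (contract_block i m U) = map_prod (collapse i m) (collapse i m) ` edges U - Id"
  by (simp add: contract_block_def edges_push_tree)

lemma weight_contract_block_pos:
  assumes "1 \<le> i" "i \<le> n" "1 \<le> m" and len: "length (weights U) = n + m - 1"
    and U: "parent_graph U" and u: "u \<in> {1..n}"
  shows "1 \<le> weight (contract_block i m U) u"
proof -
  have "verts U = {1..n + m - 1}"
    using len by (simp add: verts_def)
  then obtain v where v: "v \<in> verts U" "collapse i m v = u"
    using u image_collapse[OF assms(1-3)] by (metis imageE)
  then have "1 \<le> weight U v"
    using U by (simp add: parent_graph_def)
  also have "\<dots> \<le> (\<Sum>v | v \<in> verts U \<and> collapse i m v = u. weight U v)"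
    by (rule member_le_sum) (use v in auto)
  finally show ?thesis
    using u len assms(3) by (simp add: contract_block_def weight_push_tree)
qed

lemma contract_block_tree:
  assumes "1 \<le> i" "i \<le> n" "1 \<le> m" and len: "length (weights U) = n + m - 1"
    and U: "is_wtree U" and sub: "is_wtree (restrict_block i m U)"
  shows "is_wtree (contract_block i m U)"
    and "tree_root (contract_block i m U) = collapse i m (tree_root U)"
proof -
  have V: "verts U = {1..n + m - 1}"
    using len by (simp add: verts_def)
  interpret subtree_contraction "verts U" "{i..<i + m}" "edges U" "collapse i m" i
      "inner_label i (tree_root (restrict_block i m U))"
    by (rule subtree_contraction_block[OF assms(1-4) is_wtree_parent_graph[OF U] sub])
  have "arborescence {1..n} (edges (contract_block i m U)) (collapse i m (tree_root U))"
    using contracted_arborescence[OF is_wtree_arborescence[OF U]]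
    unfolding contracted_def edges_contract_block V image_collapse[OF assms(1-3)] .
  moreover have "verts (contract_block i m U) = {1..n}"
    using len assms(3) by (simp add: verts_def)
  ultimately show "is_wtree (contract_block i m U)"
    and "tree_root (contract_block i m U) = collapse i m (tree_root U)"
    using weight_contract_block_pos[OF assms(1-4) is_wtree_parent_graph[OF U]] tree_root_eq
    unfolding is_wtree_iff by auto
qed

text \<open>
  The direction from the contraction back to \<open>U\<close> serves twice: a graft is a tree because its
  contraction is, and the conditions on both sides of the nested associativity axiom agree.
\<close>

lemma is_wtree_iff_contract_block:
  assumes "1 \<le> i" "i \<le> n" "1 \<le> m" and len: "length (weights U) = n + m - 1"
    and U: "parent_graph U" and sub: "is_wtree (restrict_block i m U)"
  shows "is_wtree U \<longleftrightarrow> is_wtree (contract_block i m U)"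
proof
  show "is_wtree (contract_block i m U)" if "is_wtree U"
    using contract_block_tree[OF assms(1-4) that sub] by simp
  assume quot: "is_wtree (contract_block i m U)"
  have V: "verts U = {1..n + m - 1}" and V': "verts (contract_block i m U) = {1..n}"
    using len assms(3) by (simp_all add: verts_def)
  interpret subtree_contraction "verts U" "{i..<i + m}" "edges U" "collapse i m" i
      "inner_label i (tree_root (restrict_block i m U))"
    by (rule subtree_contraction_block[OF assms])
  have "arborescence (collapse i m ` verts U) contracted (tree_root (contract_block i m U))"
    using is_wtree_arborescence[OF quot]
    unfolding contracted_def edges_contract_block V V' image_collapse[OF assms(1-3)] .
  then have "\<exists>r. arborescence (verts U) (edges U) r"
    by (rule arborescence_if_contracted)
  then show "is_wtree U"
    using U by (simp add: is_wtree_iff parent_graph_def)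
qed


section \<open>Iterated blocks\<close>

lemma contract_contract_nested:
  assumes "1 \<le> i" "i \<le> n" "1 \<le> j" "j \<le> m" "1 \<le> p" and len: "length (weights U) = n + m + p - 2"
  shows "contract_block i m (contract_block (i - 1 + j) p U) = contract_block i (m + p - 1) U"
proof -
  have "collapse (i - 1 + j) p ` verts U \<subseteq> {1..n + m - 1}"
    using assms by (auto simp: collapse_def verts_def)
  moreover have "collapse i m \<circ> collapse (i - 1 + j) p = collapse i (m + p - 1)"
    using assms(1-5) by (auto simp: collapse_def fun_eq_iff)
  moreover have "length (weights U) + 1 - p = n + m - 1" "length (weights U) + 1 - (m + p - 1) = n"
    "n + m - 1 + 1 - m = n"
    using assms by auto
  ultimately show ?thesis
    using push_push[of "collapse (i - 1 + j) p" U "n + m - 1" n "collapse i m"]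
    unfolding contract_block_def length_push_tree by metis
qed

lemma restrict_contract_nested:
  assumes "1 \<le> i" "i \<le> n" "1 \<le> j" "j \<le> m" "1 \<le> p" and len: "length (weights U) = n + m + p - 2"
    and "parent_graph U"
  shows "restrict_block i m (contract_block (i - 1 + j) p U) =
    contract_block j p (restrict_block i (m + p - 1) U)"
proof -
  have "pull_tree m (inner_label i) (push_tree (n + m - 1) (collapse (i - 1 + j) p) U) =
      push_tree m (collapse j p) (pull_tree (m + p - 1) (inner_label i) U)"
  proof (rule pull_push)
    show "edges U \<subseteq> verts U \<times> verts U"
      using assms(7) by (simp add: parent_graph_def)
    show "inj_on (inner_label i) {1..m}" "inj_on (inner_label i) {1..m + p - 1}"
      by (rule inj_on_inner_label[OF assms(1)])+
    show "inner_label i ` {1..m} \<subseteq> {1..n + m - 1}" "inner_label i ` {1..m + p - 1} \<subseteq> verts U"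
      using assms(1-6) by (auto simp: inner_label_def verts_def)
    show "collapse j p y \<in> {1..m}" if "y \<in> {1..m + p - 1}" for y
      using that assms(1-5) by (auto simp: collapse_def)
    show "collapse (i - 1 + j) p (inner_label i y) = inner_label i (collapse j p y)"
      if "y \<in> {1..m + p - 1}" for y
      using that assms(1-5) by (auto simp: collapse_def inner_label_def)
    show "v \<in> inner_label i ` {1..m + p - 1}"
      if "v \<in> verts U" "collapse (i - 1 + j) p v \<in> inner_label i ` {1..m}" for v
      using that assms(1-5) unfolding image_inner_label[OF assms(1)]
      by (auto simp: collapse_def split: if_splits)
  qed
  then show ?thesis
    using assms(1-6) by (simp add: contract_block_def restrict_block_def)
qed

lemma restrict_restrict_nested:
  assumes "1 \<le> i" "1 \<le> j" "j \<le> m" "1 \<le> p"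
  shows "restrict_block j p (restrict_block i (m + p - 1) U) = restrict_block (i - 1 + j) p U"
proof -
  have "inner_label j ` {1..p} \<subseteq> {1..m + p - 1}"
    using assms by (auto simp: inner_label_def)
  moreover have "inner_label i \<circ> inner_label j = inner_label (i - 1 + j)"
    using assms by (auto simp: inner_label_def fun_eq_iff)
  ultimately show ?thesis
    by (simp add: restrict_block_def pull_pull)
qed

lemma contract_contract_disjoint:
  assumes "1 \<le> i" "i < k" "k \<le> n" "1 \<le> m" "1 \<le> p" and len: "length (weights U) = n + m + p - 2"
  shows "contract_block i m (contract_block (k - 1 + m) p U) = contract_block k p (contract_block i m U)"
proof -
  have "collapse (k - 1 + m) p ` verts U \<subseteq> {1..n + m - 1}" "collapse i m ` verts U \<subseteq> {1..n + p - 1}"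
    using assms by (auto simp: collapse_def verts_def)
  moreover have "collapse i m \<circ> collapse (k - 1 + m) p = collapse k p \<circ> collapse i m"
    using assms(1-5) by (auto simp: collapse_def fun_eq_iff)
  moreover have "length (weights U) + 1 - p = n + m - 1" "length (weights U) + 1 - m = n + p - 1"
    "n + m - 1 + 1 - m = n" "n + p - 1 + 1 - p = n"
    using assms by auto
  ultimately show ?thesis
    using push_push[of "collapse (k - 1 + m) p" U "n + m - 1" n "collapse i m"]
      push_push[of "collapse i m" U "n + p - 1" n "collapse k p"]
    unfolding contract_block_def length_push_tree by metis
qed

text \<open>The two blocks are disjoint, so contracting one only shifts the labels of the other: base change
  along the identity map of the labels of the restriction.\<close>

lemma restrict_contract_disjoint:
  assumes "1 \<le> i" "i < k" "k \<le> n" "1 \<le> m" "1 \<le> p" and len: "length (weights U) = n + m + p - 2"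
    and U: "parent_graph U"
  shows "restrict_block i m (contract_block (k - 1 + m) p U) = restrict_block i m U"
    and "restrict_block k p (contract_block i m U) = restrict_block (k - 1 + m) p U"
proof -
  have edges: "edges U \<subseteq> verts U \<times> verts U"
    using U by (simp add: parent_graph_def)
  have no_loop: "(v, v) \<notin> edges (pull_tree q g U)" for v q g
    using U by (auto simp: edges_pull_tree parent_graph_def irrefl_def)
  have "pull_tree m (inner_label i) (push_tree (n + m - 1) (collapse (k - 1 + m) p) U) =
      push_tree m id (pull_tree m (inner_label i) U)"
  proof (rule pull_push[OF edges])
    show "inj_on (inner_label i) {1..m}" "inj_on (inner_label i) {1..m}"
      by (rule inj_on_inner_label[OF assms(1)])+
    show "inner_label i ` {1..m} \<subseteq> {1..n + m - 1}" "inner_label i ` {1..m} \<subseteq> verts U"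
      using assms(1-6) by (auto simp: inner_label_def verts_def)
    show "collapse (k - 1 + m) p (inner_label i y) = inner_label i (id y)" if "y \<in> {1..m}" for y
      using that assms(1-5) by (auto simp: collapse_def inner_label_def)
    show "v \<in> inner_label i ` {1..m}"
      if "v \<in> verts U" "collapse (k - 1 + m) p v \<in> inner_label i ` {1..m}" for v
      using that assms(1-5) unfolding image_inner_label[OF assms(1)]
      by (auto simp: collapse_def split: if_splits)
  qed auto
  also have "\<dots> = pull_tree m (inner_label i) U"
    by (rule push_id[OF no_loop]) simp
  finally show "restrict_block i m (contract_block (k - 1 + m) p U) = restrict_block i m U"
    using assms(1-6) by (simp add: contract_block_def restrict_block_def)
  have k: "1 \<le> k" "1 \<le> k - 1 + m"
    using assms by auto
  have "pull_tree p (inner_label k) (push_tree (n + p - 1) (collapse i m) U) =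
      push_tree p id (pull_tree p (inner_label (k - 1 + m)) U)"
  proof (rule pull_push[OF edges])
    show "inj_on (inner_label k) {1..p}" "inj_on (inner_label (k - 1 + m)) {1..p}"
      by (rule inj_on_inner_label[OF k(1)] inj_on_inner_label[OF k(2)])+
    show "inner_label k ` {1..p} \<subseteq> {1..n + p - 1}" "inner_label (k - 1 + m) ` {1..p} \<subseteq> verts U"
      using assms(1-6) by (auto simp: inner_label_def verts_def)
    show "collapse i m (inner_label (k - 1 + m) y) = inner_label k (id y)" if "y \<in> {1..p}" for y
      using that assms(1-5) by (auto simp: collapse_def inner_label_def)
    show "v \<in> inner_label (k - 1 + m) ` {1..p}"
      if "v \<in> verts U" "collapse i m v \<in> inner_label k ` {1..p}" for v
      using that assms(1-5) unfolding image_inner_label[OF k(1)] image_inner_label[OF k(2)]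
      by (auto simp: collapse_def split: if_splits)
  qed auto
  also have "\<dots> = pull_tree p (inner_label (k - 1 + m)) U"
    by (rule push_id[OF no_loop]) simp
  finally show "restrict_block k p (contract_block i m U) = restrict_block (k - 1 + m) p U"
    using assms(1-6) by (simp add: contract_block_def restrict_block_def)
qed


section \<open>Blocks and permutations\<close>

lemma perm_comp_inner:
  assumes "1 \<le> i" "i \<le> n" "1 \<le> m" "x \<in> {1..m}"
  shows "perm_comp n m i \<sigma> \<tau> (inner_label i x) = inner_label (\<sigma> i) (\<tau> x)"
  using assms by (auto simp: perm_comp_def inner_label_def)

lemma permutes_1_bounds:
  assumes "\<sigma> permutes {1..n}" "1 \<le> x" "x \<le> n"
  shows "1 \<le> \<sigma> x" "\<sigma> x \<le> n"
  using permutes_in_image[OF assms(1), of x] assms(2,3) by auto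

text \<open>
  A block permutation induces the permutation \<open>\<sigma>\<close> on the labels left after contraction and, by
  \<open>perm_comp_inner\<close>, the permutation \<open>\<tau>\<close> on the block. Its injectivity and the compatibility of
  relabelling with contraction and restriction follow from these two facts.
\<close>

lemma collapse_perm_comp:
  assumes "1 \<le> i" "i \<le> n" "1 \<le> m" "\<sigma> permutes {1..n}" "\<tau> permutes {1..m}" "k \<in> {1..n + m - 1}"
  shows "collapse (\<sigma> i) m (perm_comp n m i \<sigma> \<tau> k) = \<sigma> (collapse i m k)"
proof -
  have neq: "x \<noteq> i \<Longrightarrow> \<sigma> x \<noteq> \<sigma> i" for x
    using permutes_inj[OF assms(4)] by (auto dest: injD)
  consider "k < i" | "i \<le> k" "k < i + m" | "i + m \<le> k"
    by linarith
  then show ?thesis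
  proof cases
    case 1
    then show ?thesis
      using assms collapse_outer[OF assms(3) neq[of k]]
      by (simp add: perm_comp_def collapse_def[of i])
  next
    case 2
    then have "\<tau> (k + 1 - i) \<in> {1..m}"
      using permutes_in_image[OF assms(5), of "k + 1 - i"] by auto
    moreover have "1 \<le> \<sigma> i"
      using permutes_1_bounds[OF assms(4)] assms by auto
    ultimately show ?thesis
      using assms 2 by (auto simp: perm_comp_def collapse_def inner_label_def)
  next
    case 3
    then show ?thesis
      using assms collapse_outer[OF assms(3) neq[of "k + 1 - m"]]
      by (simp add: perm_comp_def collapse_def[of i])
  qed
qed

lemma perm_comp_permutes:
  assumes "1 \<le> i" "i \<le> n" "1 \<le> m" "\<sigma> permutes {1..n}" "\<tau> permutes {1..m}"
  shows "perm_comp n m i \<sigma> \<tau> permutes {1..n + m - 1}" (is "?\<rho> permutes ?N")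
proof (rule bij_imp_permutes)
  show "?\<rho> x = x" if "x \<notin> ?N" for x
    using that by (simp add: perm_comp_def)
  have into: "?\<rho> k \<in> ?N" if k: "k \<in> ?N" for k
  proof -
    have "?\<rho> k \<noteq> 0 \<and> ?\<rho> k \<le> n + m - 1"
    proof (cases "i \<le> k \<and> k < i + m")
      case True
      then have "\<tau> (k + 1 - i) \<in> {1..m}"
        using permutes_in_image[OF assms(5), of "k + 1 - i"] by auto
      then show ?thesis
        using True k permutes_1_bounds[OF assms(4,1,2)]
        by (auto simp: perm_comp_def inner_label_def)
    next
      case False
      have *: "1 \<le> \<sigma> x \<and> \<sigma> x \<le> n \<and> \<sigma> x \<noteq> \<sigma> i" if "x \<in> {1..n}" "x \<noteq> i" for x
        using that permutes_1_bounds[OF assms(4)] permutes_inj[OF assms(4)] by (auto dest: injD)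
      show ?thesis
      proof (cases "k < i")
        case True
        with k assms(1-3) *[of k] show ?thesis
          by (simp add: perm_comp_def outer_label_def) linarith
      next
        case False
        with \<open>\<not> (i \<le> k \<and> k < i + m)\<close> have "i + m \<le> k"
          by simp
        with k assms(1-3) *[of "k + 1 - m"] show ?thesis
          by (simp add: perm_comp_def outer_label_def) linarith
      qed
    qed
    then show ?thesis
      by simp
  qed
  have "inj_on ?\<rho> ?N"
  proof (rule inj_onI)
    fix k k' assume k: "k \<in> ?N" "k' \<in> ?N" "?\<rho> k = ?\<rho> k'"
    then have "\<sigma> (collapse i m k) = \<sigma> (collapse i m k')"
      using collapse_perm_comp[OF assms] by metis
    then have "collapse i m k = collapse i m k'"
      using permutes_inj[OF assms(4)] by (auto dest: injD)
    then consider "k = k'" | "k \<in> {i..<i + m}" "k' \<in> {i..<i + m}"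
      using collapse_eq_iff[OF assms(3)] by blast
    then show "k = k'"
    proof cases
      case 2
      then obtain x x' where x: "x \<in> {1..m}" "x' \<in> {1..m}" "k = inner_label i x" "k' = inner_label i x'"
        unfolding image_inner_label[OF assms(1), symmetric] by blast
      then have "inner_label (\<sigma> i) (\<tau> x) = inner_label (\<sigma> i) (\<tau> x')"
        using k perm_comp_inner[OF assms(1-3)] by metis
      then have "\<tau> x = \<tau> x'"
        using permutes_1_bounds[OF assms(4,1,2)] by (auto simp: inner_label_def)
      then show ?thesis
        using x permutes_inj[OF assms(5)] by (auto dest: injD)
    qed
  qed
  moreover have "?\<rho> ` ?N \<subseteq> ?N"
    using into by blast
  ultimately show "bij_betw ?\<rho> ?N ?N"
    by (simp add: bij_betw_def endo_inj_surj)
qed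

lemma contract_relabel:
  assumes "1 \<le> i" "i \<le> n" "1 \<le> m" "\<sigma> permutes {1..n}" "\<tau> permutes {1..m}"
    and U: "is_wtree U" and len: "length (weights U) = n + m - 1"
  shows "contract_block i m (relabel U (perm_comp n m i \<sigma> \<tau>)) = relabel (contract_block (\<sigma> i) m U) \<sigma>"
proof -
  define \<rho> where "\<rho> = perm_comp n m i \<sigma> \<tau>"
  have \<rho>: "\<rho> permutes {1..n + m - 1}"
    unfolding \<rho>_def by (rule perm_comp_permutes[OF assms(1-5)])
  have \<sigma>i: "1 \<le> \<sigma> i" "\<sigma> i \<le> n"
    using permutes_1_bounds[OF assms(4,1,2)] .
  have V: "verts U = {1..n + m - 1}"
    using len by (simp add: verts_def)
  have "contract_block i m (relabel U \<rho>) = push_tree n (collapse i m) (push_tree (n + m - 1) (inv \<rho>) U)"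
    using relabel_eq_push[OF \<rho> len is_wtree_irrefl[OF U]] assms(3) by (simp add: contract_block_def)
  also have "\<dots> = push_tree n (collapse i m \<circ> inv \<rho>) U"
    by (rule push_push) (use permutes_image[OF permutes_inv[OF \<rho>]] V in simp)
  also have "\<dots> = push_tree n (inv \<sigma> \<circ> collapse (\<sigma> i) m) U"
  proof (rule push_cong[OF is_wtree_edges[OF U]])
    fix v assume "v \<in> verts U"
    then have "inv \<rho> v \<in> {1..n + m - 1}"
      using permutes_in_image[OF permutes_inv[OF \<rho>]] V by blast
    then have "collapse (\<sigma> i) m (\<rho> (inv \<rho> v)) = \<sigma> (collapse i m (inv \<rho> v))"
      unfolding \<rho>_def by (rule collapse_perm_comp[OF assms(1-5)])
    then show "(collapse i m \<circ> inv \<rho>) v = (inv \<sigma> \<circ> collapse (\<sigma> i) m) v"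
      using permutes_inverses[OF \<rho>] permutes_inverses[OF assms(4)] by simp
  qed
  also have "\<dots> = push_tree n (inv \<sigma>) (push_tree n (collapse (\<sigma> i) m) U)"
    by (rule push_push[symmetric]) (use image_collapse[OF \<sigma>i assms(3)] V in simp)
  also have "\<dots> = push_tree n (inv \<sigma>) (contract_block (\<sigma> i) m U)"
    using len assms(3) by (simp add: contract_block_def)
  also have "\<dots> = relabel (contract_block (\<sigma> i) m U) \<sigma>"
    by (rule relabel_eq_push[OF assms(4), symmetric])
      (use len assms(3) in \<open>auto simp: edges_contract_block\<close>)
  finally show ?thesis
    unfolding \<rho>_def .
qed

lemma restrict_relabel:
  assumes "1 \<le> i" "i \<le> n" "1 \<le> m" "\<sigma> permutes {1..n}" "\<tau> permutes {1..m}"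
    and U: "is_wtree U" and len: "length (weights U) = n + m - 1"
  shows "restrict_block i m (relabel U (perm_comp n m i \<sigma> \<tau>)) = relabel (restrict_block (\<sigma> i) m U) \<tau>"
proof -
  define \<rho> where "\<rho> = perm_comp n m i \<sigma> \<tau>"
  have \<rho>: "\<rho> permutes {1..n + m - 1}"
    unfolding \<rho>_def by (rule perm_comp_permutes[OF assms(1-5)])
  have \<sigma>i: "1 \<le> \<sigma> i" "\<sigma> i \<le> n"
    using permutes_1_bounds[OF assms(4,1,2)] .
  have V: "verts U = {1..n + m - 1}"
    using len by (simp add: verts_def)
  have \<tau>': "inv \<tau> permutes {1..m}"
    by (rule permutes_inv[OF assms(5)])
  have inner: "inv \<rho> (inner_label (\<sigma> i) y) = inner_label i (inv \<tau> y)" if "y \<in> {1..m}" for y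
  proof -
    have "inv \<tau> y \<in> {1..m}"
      using that permutes_in_image[OF \<tau>'] by blast
    then have "\<rho> (inner_label i (inv \<tau> y)) = inner_label (\<sigma> i) y"
      using perm_comp_inner[OF assms(1-3)] permutes_inverses[OF assms(5)] by (simp add: \<rho>_def)
    from this[symmetric] show ?thesis
      by (simp add: permutes_inverses(2)[OF \<rho>])
  qed
  have "pull_tree m (inner_label i) (push_tree (n + m - 1) (inv \<rho>) U) =
      push_tree m (inv \<tau>) (pull_tree m (inner_label (\<sigma> i)) U)"
  proof (rule pull_push[OF is_wtree_edges[OF U]])
    show "inj_on (inner_label i) {1..m}" "inj_on (inner_label (\<sigma> i)) {1..m}"
      by (rule inj_on_inner_label[OF assms(1)] inj_on_inner_label[OF \<sigma>i(1)])+
    show "inner_label i ` {1..m} \<subseteq> {1..n + m - 1}" "inner_label (\<sigma> i) ` {1..m} \<subseteq> verts U"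
      unfolding image_inner_label[OF assms(1)] image_inner_label[OF \<sigma>i(1)] V
      using \<sigma>i assms(1-3) by (simp_all add: subset_iff) linarith+
    show "inv \<tau> y \<in> {1..m}" if "y \<in> {1..m}" for y
      using that permutes_in_image[OF \<tau>'] by blast
    show "inv \<rho> (inner_label (\<sigma> i) y) = inner_label i (inv \<tau> y)" if "y \<in> {1..m}" for y
      by (rule inner[OF that])
    show "v \<in> inner_label (\<sigma> i) ` {1..m}" if "v \<in> verts U" "inv \<rho> v \<in> inner_label i ` {1..m}" for v
    proof -
      obtain x where x: "x \<in> {1..m}" "inv \<rho> v = inner_label i x"
        using \<open>inv \<rho> v \<in> inner_label i ` {1..m}\<close> by blast
      then have "v = \<rho> (inner_label i x)"
        using permutes_inverses(1)[OF \<rho>, of v] by simp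
      also have "\<dots> = inner_label (\<sigma> i) (\<tau> x)"
        unfolding \<rho>_def by (rule perm_comp_inner[OF assms(1-3) x(1)])
      finally show ?thesis
        using x(1) permutes_in_image[OF assms(5)] by blast
    qed
  qed
  then have "restrict_block i m (relabel U \<rho>) = push_tree m (inv \<tau>) (restrict_block (\<sigma> i) m U)"
    using relabel_eq_push[OF \<rho> len is_wtree_irrefl[OF U]] by (simp add: restrict_block_def)
  also have "\<dots> = relabel (restrict_block (\<sigma> i) m U) \<tau>"
    by (rule relabel_eq_push[OF assms(5), symmetric])
      (use is_wtree_irrefl[OF U] in \<open>auto simp: restrict_block_def edges_pull_tree\<close>)
  finally show ?thesis
    unfolding \<rho>_def .
qed


section \<open>Grafting as the inverse of contraction and restriction\<close>

lemma weight_contract_block_outside: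
  assumes "1 \<le> i" "i \<le> n" "1 \<le> m" and len: "length (weights U) = n + m - 1"
    and v: "v \<in> verts U" "v \<notin> {i..<i + m}"
  shows "weight (contract_block i m U) (collapse i m v) = weight U v"
proof -
  have "collapse i m v \<in> {1..n}"
    using image_collapse[OF assms(1-3)] v len by (auto simp: verts_def)
  moreover have "{w. w \<in> verts U \<and> collapse i m w = collapse i m v} = {v}"
    using v collapse_eq_iff[OF assms(3)] by auto
  ultimately show ?thesis
    using len assms(3) by (simp add: contract_block_def weight_push_tree)
qed

lemma weight_contract_block_inside:
  assumes "1 \<le> i" "i \<le> n" "1 \<le> m" and len: "length (weights U) = n + m - 1"
  shows "weight (contract_block i m U) i = tree_weight (restrict_block i m U)"
proof -
  have "{i..<i + m} \<subseteq> verts U"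
    using assms by (auto simp: verts_def)
  then have "{v. v \<in> verts U \<and> collapse i m v = i} = inner_label i ` {1..m}"
    using collapse_eq_block[OF assms(3)] image_inner_label[OF assms(1)] by auto
  then have "weight (contract_block i m U) i = (\<Sum>v\<in>inner_label i ` {1..m}. weight U v)"
    using assms by (simp add: contract_block_def weight_push_tree)
  also have "\<dots> = (\<Sum>x\<in>{1..m}. weight U (inner_label i x))"
    by (simp add: sum.reindex[OF inj_on_inner_label[OF assms(1)]])
  also have "\<dots> = (\<Sum>x\<in>{1..m}. weight (restrict_block i m U) x)"
    unfolding restrict_block_def by (intro sum.cong refl) (simp add: weight_pull_tree)
  also have "\<dots> = tree_weight (restrict_block i m U)"
    by (simp add: tree_weight_def restrict_block_def)
  finally show ?thesis .
qed

lemma edges_graft_iff: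
  assumes "length (weights T) = m"
  shows "(a, b) \<in> edges (graft i f S T) \<longleftrightarrow>
    (\<exists>c p. (c, p) \<in> edges S \<and> c \<noteq> i \<and> p \<noteq> i \<and> a = outer_label i m c \<and> b = outer_label i m p) \<or>
    (\<exists>c p. (c, p) \<in> edges T \<and> a = inner_label i c \<and> b = inner_label i p) \<or>
    (\<exists>c. (c, i) \<in> edges S \<and> a = outer_label i m c \<and> b = inner_label i (f (c, i))) \<or>
    (\<exists>p. (i, p) \<in> edges S \<and> a = inner_label i (tree_root T) \<and> b = outer_label i m p)"
  using assms by (auto simp: graft_def Let_def in_edges_def)

text \<open>
  Nothing is fixed about \<open>f\<close> outside the edges arriving at \<open>i\<close>, so that both the extensional
  functions in the sum defining the composition and the constant function of the reference graft
  are instances.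
\<close>

locale grafting =
  fixes i n m :: nat and S T :: wtree and f :: "nat \<times> nat \<Rightarrow> nat"
  assumes i: "1 \<le> i" "i \<le> n" and S: "S \<in> wtrees n" and T: "T \<in> wtrees m"
    and f: "\<And>e. e \<in> in_edges S i \<Longrightarrow> f e \<in> verts T"
begin

abbreviation G :: wtree where "G \<equiv> graft i f S T"

lemma trees: "is_wtree S" "is_wtree T" and len: "length (weights S) = n" "length (weights T) = m"
  using S T by (auto simp: wtrees_def)

lemma verts: "verts S = {1..n}" "verts T = {1..m}"
  using len by (simp_all add: verts_def)

lemma root_in: "tree_root T \<in> {1..m}"
  using arborescence_root_in[OF is_wtree_arborescence[OF trees(2)]] verts by simp

lemma m: "1 \<le> m"
  using root_in by auto

lemma len_graft: "length (weights G) = n + m - 1"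
  using len i by (simp add: graft_def Let_def insert_degree_def)

lemma verts_graft: "verts G = {1..n + m - 1}"
  using len_graft by (simp add: verts_def)

lemma f_in: "(c, i) \<in> edges S \<Longrightarrow> f (c, i) \<in> {1..m}"
  using f[of "(c, i)"] verts by (simp add: in_edges_def)

lemma inner_in_block: "x \<in> {1..m} \<Longrightarrow> inner_label i x \<in> {i..<i + m}"
  using image_inner_label[OF i(1)] by blast

lemma outer_notin_block: "y \<noteq> i \<Longrightarrow> outer_label i m y \<notin> {i..<i + m}"
  using m by (auto simp: outer_label_def)

lemma edges_S: "(c, p) \<in> edges S \<Longrightarrow> c \<in> {1..n} \<and> p \<in> {1..n} \<and> c \<noteq> p"
  using is_wtree_edges[OF trees(1)] is_wtree_irrefl[OF trees(1)] verts by auto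

lemma edges_T: "(c, p) \<in> edges T \<Longrightarrow> c \<in> {1..m} \<and> p \<in> {1..m} \<and> c \<noteq> p"
  using is_wtree_edges[OF trees(2)] is_wtree_irrefl[OF trees(2)] verts by auto

lemma inner_inj: "inner_label i x = inner_label i y \<Longrightarrow> x = y"
  using inj_on_inner_label[OF i(1), of UNIV] by (auto dest: injD)

lemma outer_inj: "outer_label i m x = outer_label i m y \<Longrightarrow> x \<noteq> i \<Longrightarrow> y \<noteq> i \<Longrightarrow> x = y"
  using collapse_outer[OF m] by metis

lemma inner_neq_outer: "x \<in> {1..m} \<Longrightarrow> y \<noteq> i \<Longrightarrow> inner_label i x \<noteq> outer_label i m y"
  using inner_in_block[of x] outer_notin_block[of y] by auto

lemma graft_edge_cases:
  assumes "(a, b) \<in> edges G"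
  obtains (outer) c p where "(c, p) \<in> edges S" "c \<noteq> i" "p \<noteq> i"
      "a = outer_label i m c" "b = outer_label i m p"
  | (inner) c p where "(c, p) \<in> edges T" "c \<in> {1..m}" "p \<in> {1..m}"
      "a = inner_label i c" "b = inner_label i p"
  | (enter) c where "(c, i) \<in> edges S" "c \<noteq> i" "f (c, i) \<in> {1..m}"
      "a = outer_label i m c" "b = inner_label i (f (c, i))"
  | (leave) p where "(i, p) \<in> edges S" "p \<noteq> i"
      "a = inner_label i (tree_root T)" "b = outer_label i m p"
  using assms edges_S edges_T f_in unfolding edges_graft_iff[OF len(2)] by blast

lemma weight_graft_inner:
  assumes "x \<in> {1..m}"
  shows "weight G (inner_label i x) = weight T x"
  using assms i len
  by (auto simp: weight_def graft_def Let_def insert_degree_def inner_label_def nth_append)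

lemma weight_graft_outer:
  assumes "y \<in> {1..n}" "y \<noteq> i"
  shows "weight G (outer_label i m y) = weight S y"
proof (cases "y < i")
  case True
  then show ?thesis
    using assms i len
    by (simp add: weight_def graft_def Let_def insert_degree_def outer_label_def nth_append) linarith
next
  case False
  then have "\<not> y + m - 1 - 1 < i - 1" "\<not> y + m - 1 - 1 - (i - 1) < m"
      "i + (y + m - 1 - 1 - (i - 1) - m) = y - 1"
    using assms m i by auto
  then show ?thesis
    using assms i len False
    by (simp add: weight_def graft_def Let_def insert_degree_def outer_label_def nth_append)
qed

lemma restrict_graft: "restrict_block i m G = T"
proof (rule wtree_eqI)
  fix x assume "x \<in> verts T"
  then show "weight (restrict_block i m G) x = weight T x"
    using weight_graft_inner by (simp add: restrict_block_def weight_pull_tree verts)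
next
  show "edges (restrict_block i m G) = edges T" (is "?L = ?R")
  proof (intro equalityI subrelI)
    fix x y assume "(x, y) \<in> ?L"
    then have xy: "x \<in> {1..m}" "y \<in> {1..m}" and e: "(inner_label i x, inner_label i y) \<in> edges G"
      by (auto simp: restrict_block_def edges_pull_tree)
    from e show "(x, y) \<in> ?R"
      by (cases rule: graft_edge_cases) (use inner_neq_outer[OF xy(1)] inner_neq_outer[OF xy(2)] in \<open>auto dest: inner_inj\<close>)
  next
    fix x y assume e: "(x, y) \<in> ?R"
    then have "(inner_label i x, inner_label i y) \<in> edges G"
      unfolding edges_graft_iff[OF len(2)] by blast
    then show "(x, y) \<in> ?L"
      using edges_T[OF e] by (simp add: restrict_block_def edges_pull_tree)
  qed
qed (simp add: len)

text \<open>The weights of the block add up to the weight of the vertex which it replaced; this is what the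
  condition \<open>|T| = |v|\<close> is for.\<close>

lemma contract_graft:
  assumes "tree_weight T = weight S i"
  shows "contract_block i m G = S"
proof (rule wtree_eqI)
  show "length (weights (contract_block i m G)) = length (weights S)"
    using len len_graft m by simp
next
  fix u assume "u \<in> verts S"
  then have u: "u \<in> {1..n}"
    using verts by simp
  show "weight (contract_block i m G) u = weight S u"
  proof (cases "u = i")
    case True
    then show ?thesis
      using weight_contract_block_inside[OF i m len_graft] assms restrict_graft by simp
  next
    case False
    have "outer_label i m u \<in> verts G"
      using u m by (auto simp: verts_graft outer_label_def)
    then show ?thesis
      using weight_contract_block_outside[OF i m len_graft _ outer_notin_block[OF False]]
        collapse_outer[OF m False] weight_graft_outer[OF u False] by simp
  qed
next
  have c_inner: "collapse i m (inner_label i x) = i" if "x \<in> {1..m}" for x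
    using inner_in_block[OF that] collapse_eq_block[OF m] by blast
  show "edges (contract_block i m G) = edges S" (is "?L = ?R")
  proof (intro equalityI subrelI)
    fix x y assume "(x, y) \<in> ?L"
    then obtain a b where ab: "(a, b) \<in> edges G" "x = collapse i m a" "y = collapse i m b" "x \<noteq> y"
      by (auto simp: edges_contract_block)
    from ab(1) show "(x, y) \<in> ?R"
      by (cases rule: graft_edge_cases)
        (use ab(2-4) collapse_outer[OF m] c_inner c_inner[OF root_in] in simp_all)
  next
    fix x y assume e: "(x, y) \<in> ?R"
    then have "x \<noteq> y"
      using edges_S by auto
    have "\<exists>a b. (a, b) \<in> edges G \<and> collapse i m a = x \<and> collapse i m b = y"
    proof -
      consider "x = i" "y \<noteq> i" | "x \<noteq> i" "y = i" | "x \<noteq> i" "y \<noteq> i"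
        using \<open>x \<noteq> y\<close> by auto
      then show ?thesis
      proof cases
        case 1
        then have "(inner_label i (tree_root T), outer_label i m y) \<in> edges G"
          using e unfolding edges_graft_iff[OF len(2)] by blast
        then show ?thesis
          using 1 c_inner[OF root_in] collapse_outer[OF m] by blast
      next
        case 2
        then have "(outer_label i m x, inner_label i (f (x, i))) \<in> edges G"
          using e unfolding edges_graft_iff[OF len(2)] by blast
        then show ?thesis
          using 2 c_inner[OF f_in] e collapse_outer[OF m] by blast
      next
        case 3
        then have "(outer_label i m x, outer_label i m y) \<in> edges G"
          using e unfolding edges_graft_iff[OF len(2)] by blast
        then show ?thesis
          using 3 collapse_outer[OF m] by blast
      qed
    qed
    then show "(x, y) \<in> ?L"
      using \<open>x \<noteq> y\<close> by (force simp: edges_contract_block)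
  qed
qed

lemma parent_graph_graft: "parent_graph G"
  unfolding parent_graph_def
proof (intro conjI ballI)
  have inner_verts: "inner_label i x \<in> verts G" if "x \<in> {1..m}" for x
    using that i by (auto simp: verts_graft inner_label_def)
  have outer_verts: "outer_label i m y \<in> verts G" if "y \<in> {1..n}" for y
    using that m by (auto simp: verts_graft outer_label_def)
  show "edges G \<subseteq> verts G \<times> verts G"
  proof (intro subrelI)
    fix a b assume "(a, b) \<in> edges G"
    then show "(a, b) \<in> verts G \<times> verts G"
      unfolding edges_graft_iff[OF len(2)]
      using inner_verts outer_verts edges_S edges_T f_in root_in by blast
  qed
  show "1 \<le> weight G v" if v: "v \<in> verts G" for v
  proof (cases "v \<in> {i..<i + m}")
    case True
    then obtain x where "x \<in> {1..m}" "v = inner_label i x"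
      using image_inner_label[OF i(1)] by blast
    then show ?thesis
      using weight_graft_inner is_wtree_weight[OF trees(2)] verts by simp
  next
    case False
    have "collapse i m v \<in> {1..n}"
      using v image_collapse[OF i m] verts_graft by blast
    moreover have "collapse i m v \<noteq> i"
      using False collapse_eq_block[OF m] by blast
    ultimately show ?thesis
      using weight_graft_outer outer_collapse[OF m False] is_wtree_weight[OF trees(1)] verts
      by metis
  qed
  note sv_S = arborescence_parent_unique[OF is_wtree_arborescence[OF trees(1)]]
  note sv_T = arborescence_parent_unique[OF is_wtree_arborescence[OF trees(2)]]
  have no_parent: "(tree_root T, p) \<notin> edges T" for p
    by (rule arborescence_no_parent[OF is_wtree_arborescence[OF trees(2)]])
  have from_outer: "\<exists>p. (c, p) \<in> edges S \<and> b = (if p = i then inner_label i (f (c, i)) else outer_label i m p)"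
    if "(outer_label i m c, b) \<in> edges G" "c \<noteq> i" for c b
    using that(1)
  proof (cases rule: graft_edge_cases)
    case (outer c' p)
    then show ?thesis
      using outer_inj[of c c'] that by auto
  next
    case (inner c' p)
    then show ?thesis
      using inner_neq_outer[of c' c] that by auto
  next
    case (enter c')
    then show ?thesis
      using outer_inj[of c c'] that by auto
  next
    case (leave p)
    then show ?thesis
      using inner_neq_outer[OF root_in, of c] that by auto
  qed
  have from_inner: "(\<exists>p. (x, p) \<in> edges T \<and> b = inner_label i p) \<or>
      x = tree_root T \<and> (\<exists>p. (i, p) \<in> edges S \<and> b = outer_label i m p)"
    if "(inner_label i x, b) \<in> edges G" "x \<in> {1..m}" for x b
    using that(1)
  proof (cases rule: graft_edge_cases)
    case (outer c' p)
    then show ?thesis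
      using inner_neq_outer[OF that(2), of c'] by auto
  next
    case (inner c' p)
    then show ?thesis
      using inner_inj[of x c'] by auto
  next
    case (enter c')
    then show ?thesis
      using inner_neq_outer[OF that(2), of c'] by auto
  next
    case (leave p)
    then show ?thesis
      using inner_inj[of x "tree_root T"] by auto
  qed
  have source: "(\<exists>c. c \<noteq> i \<and> a = outer_label i m c) \<or> (\<exists>x\<in>{1..m}. a = inner_label i x)"
    if "(a, b) \<in> edges G" for a b
    using that root_in by (cases rule: graft_edge_cases) blast+
  show "single_valued (edges G)"
  proof (rule single_valuedI)
    fix a b b' assume e: "(a, b) \<in> edges G" "(a, b') \<in> edges G"
    from source[OF e(1)] show "b = b'"
    proof
      assume "\<exists>c. c \<noteq> i \<and> a = outer_label i m c"
      then obtain c where "c \<noteq> i" "a = outer_label i m c"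
        by blast
      then show ?thesis
        using from_outer[of c b] from_outer[of c b'] e sv_S by auto
    next
      assume "\<exists>x\<in>{1..m}. a = inner_label i x"
      then obtain x where "x \<in> {1..m}" "a = inner_label i x"
        by blast
      then show ?thesis
        using from_inner[of x b] from_inner[of x b'] e sv_S sv_T no_parent by blast
    qed
  qed
  show "irrefl (edges G)"
  proof (rule irreflI)
    fix a show "(a, a) \<notin> edges G"
    proof
      assume "(a, a) \<in> edges G"
      then show False
      proof (cases rule: graft_edge_cases)
        case (outer c p)
        then show ?thesis
          using outer_inj[of c p] edges_S by auto
      next
        case (inner c p)
        then show ?thesis
          using inner_inj[of c p] edges_T by auto
      next
        case (enter c)
        then show ?thesis
          using inner_neq_outer[of "f (c, i)" c] by auto
      next
        case (leave p)
        then show ?thesis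
          using inner_neq_outer[OF root_in, of p] by auto
      qed
    qed
  qed
qed

lemma graft_tree:
  assumes "tree_weight T = weight S i"
  shows "G \<in> wtrees (n + m - 1)"
  using is_wtree_iff_contract_block[OF i m len_graft parent_graph_graft]
    contract_graft[OF assms] restrict_graft trees len_graft by (simp add: wtrees_def)

end

lemma graft_inject:
  assumes "grafting i n m S T f" "grafting i n m S T f'" and eq: "graft i f S T = graft i f' S T"
    and e: "e \<in> in_edges S i"
  shows "f e = f' e"
proof -
  interpret g: grafting i n m S T f
    by fact
  interpret g': grafting i n m S T f'
    by fact
  obtain c where c: "e = (c, i)" "(c, i) \<in> edges S"
    using e by (cases e) (auto simp: in_edges_def)
  have "(outer_label i m c, inner_label i (f (c, i))) \<in> edges g.G"
    unfolding edges_graft_iff[OF g.len(2)] using c by blast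
  moreover have "(outer_label i m c, inner_label i (f' (c, i))) \<in> edges g.G"
    unfolding eq edges_graft_iff[OF g.len(2)] using c by blast
  ultimately have "inner_label i (f (c, i)) = inner_label i (f' (c, i))"
    using g.parent_graph_graft by (auto simp: parent_graph_def dest: single_valuedD)
  then show ?thesis
    using inj_on_inner_label[OF g.i(1), of UNIV] c by (auto dest: injD)
qed

text \<open>
  The map \<open>f\<close> is read off from the parents in \<open>U\<close>. It is enough to see that the graft contains all edges
  of \<open>U\<close>, as both are trees on the same vertices.
\<close>

lemma graft_contract_restrict:
  assumes i: "1 \<le> i" "i \<le> n" and m: "1 \<le> m" and U: "U \<in> wtrees (n + m - 1)"
    and sub: "is_wtree (restrict_block i m U)"
  defines "S \<equiv> contract_block i m U" and "T \<equiv> restrict_block i m U"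
  shows "\<exists>f. grafting i n m S T f \<and> U = graft i f S T"
proof -
  have tree: "is_wtree U" and len: "length (weights U) = n + m - 1"
    using U by (auto simp: wtrees_def)
  have V: "verts U = {1..n + m - 1}"
    using len by (simp add: verts_def)
  interpret subtree_contraction "verts U" "{i..<i + m}" "edges U" "collapse i m" i
      "inner_label i (tree_root (restrict_block i m U))"
    by (rule subtree_contraction_block[OF i m len is_wtree_parent_graph[OF tree] sub])
  have S: "S \<in> wtrees n" and T: "T \<in> wtrees m"
    using contract_block_tree[OF i m len tree sub] sub len m by (auto simp: wtrees_def S_def T_def)
  have ES: "edges S = contracted"
    by (simp add: S_def edges_contract_block contracted_def)
  have "\<forall>e\<in>in_edges S i. \<exists>y. y \<in> {1..m} \<and> (outer_label i m (fst e), inner_label i y) \<in> edges U"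
  proof
    fix e assume "e \<in> in_edges S i"
    then obtain x where e: "e = (x, i)" "(x, i) \<in> contracted"
      by (cases e) (auto simp: in_edges_def ES)
    then obtain v p where vp: "(v, p) \<in> edges U" "x = collapse i m v" "i = collapse i m p"
        "\<not> (v \<in> {i..<i + m} \<and> p \<in> {i..<i + m})"
      unfolding contracted_iff by blast
    then have p: "p \<in> {i..<i + m}"
      using collapse_eq_block[OF m, of i p] by simp
    then obtain y where "y \<in> {1..m}" "p = inner_label i y"
      using image_inner_label[OF i(1)] by blast
    moreover have "outer_label i m x = v"
      using vp(2,4) p outer_collapse[OF m, of v i] by blast
    ultimately show "\<exists>y. y \<in> {1..m} \<and> (outer_label i m (fst e), inner_label i y) \<in> edges U"
      using vp e by auto
  qed
  from bchoice[OF this] obtain f where f: "\<And>e. e \<in> in_edges S i \<Longrightarrow>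
      f e \<in> {1..m} \<and> (outer_label i m (fst e), inner_label i (f e)) \<in> edges U"
    by blast
  have "verts T = {1..m}"
    by (simp add: T_def restrict_block_def)
  then interpret g: grafting i n m S T f
    by unfold_locales (use i S T f in auto)
  have w: "tree_weight T = weight S i"
    using weight_contract_block_inside[OF i m len] by (simp add: S_def T_def)
  have G: "is_wtree g.G"
    using g.graft_tree[OF w] by (simp add: wtrees_def)
  have "edges U \<subseteq> edges g.G"
  proof (rule subrelI)
    fix v p assume e: "(v, p) \<in> edges U"
    consider "v \<in> {i..<i + m}" "p \<in> {i..<i + m}" | "v \<in> {i..<i + m}" "p \<notin> {i..<i + m}"
      | "v \<notin> {i..<i + m}" "p \<in> {i..<i + m}" | "v \<notin> {i..<i + m}" "p \<notin> {i..<i + m}"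
      by blast
    then show "(v, p) \<in> edges g.G"
    proof cases
      case 1
      then have "(v, p) \<in> map_prod (inner_label i) (inner_label i) ` edges T"
        using e edges_restrict_block[OF i(1)] by (simp add: T_def)
      then show ?thesis
        unfolding edges_graft_iff[OF g.len(2)] by auto
    next
      case 2
      then have "v = inner_label i (tree_root T)"
        using exit_from_root[OF e] by (simp add: T_def)
      moreover have "(i, collapse i m p) \<in> edges S"
        using contractedI[OF e] 2 collapse_eq_block[OF m, of i v] by (auto simp: ES)
      moreover have "p = outer_label i m (collapse i m p)"
        using outer_collapse[OF m 2(2)] by simp
      ultimately show ?thesis
        unfolding edges_graft_iff[OF g.len(2)] by blast
    next
      case 3
      then have cv: "(collapse i m v, i) \<in> edges S"
        using contractedI[OF e] collapse_eq_block[OF m, of i p] by (auto simp: ES)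
      have v: "v = outer_label i m (collapse i m v)"
        using outer_collapse[OF m 3(1)] by simp
      have "(v, inner_label i (f (collapse i m v, i))) \<in> edges U"
        using f[of "(collapse i m v, i)"] cv v by (simp add: in_edges_def)
      then have "p = inner_label i (f (collapse i m v, i))"
        using functional[OF e] by blast
      then show ?thesis
        using cv v unfolding edges_graft_iff[OF g.len(2)] by blast
    next
      case 4
      then have "(collapse i m v, collapse i m p) \<in> edges S" "collapse i m v \<noteq> i"
          "collapse i m p \<noteq> i"
        using contractedI[OF e] collapse_eq_block[OF m] by (auto simp: ES)
      then show ?thesis
        using outer_collapse[OF m 4(1)] outer_collapse[OF m 4(2)]
        unfolding edges_graft_iff[OF g.len(2)] by metis
    qed
  qed
  then have edges: "edges U = edges g.G"
    using arborescence_subset_eq[OF is_wtree_arborescence[OF tree]] is_wtree_arborescence[OF G]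
    unfolding V g.verts_graft by blast
  have "U = g.G"
  proof (rule wtree_eqI)
    show "length (weights U) = length (weights g.G)"
      using len g.len_graft by simp
    show "edges U = edges g.G"
      by (rule edges)
    fix v assume v: "v \<in> verts g.G"
    show "weight U v = weight g.G v"
    proof (cases "v \<in> {i..<i + m}")
      case True
      then obtain x where x: "x \<in> {1..m}" "v = inner_label i x"
        using image_inner_label[OF i(1)] by blast
      then show ?thesis
        using g.weight_graft_inner[OF x(1)] by (simp add: T_def restrict_block_def weight_pull_tree)
    next
      case False
      have "v \<in> verts U"
        using v by (simp add: V g.verts_graft)
      then show ?thesis
        using weight_contract_block_outside[OF i m len _ False]
          weight_contract_block_outside[OF i m g.len_graft v False]
        unfolding g.contract_graft[OF w] by (simp add: S_def)
    qed
  qed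
  then show ?thesis
    using g.grafting_axioms by blast
qed


section \<open>Potential energy\<close>

text \<open>
  The weight of the contracted vertex is distributed over the vertices of the block. Each vertex \<open>v\<close>
  of \<open>U\<close> then contributes to the left-hand side its weight times the depth of its image in
  the contraction plus, inside the block, its depth there: this is \<open>split_depth\<close>, which is at most the
  height of \<open>v\<close> in \<open>U\<close>, with equality if the block is only entered at its root.
\<close>

lemma
  assumes i: "1 \<le> i" "i \<le> n" and m: "1 \<le> m" and U: "U \<in> wtrees (n + m - 1)"
    and sub: "is_wtree (restrict_block i m U)"
  shows energy_contract_restrict_le:
      "energy (contract_block i m U) + energy (restrict_block i m U) \<le> energy U"
    and energy_contract_restrict_eq:
      "(\<And>v p. (v, p) \<in> edges U \<Longrightarrow> v \<notin> {i..<i + m} \<Longrightarrow> p \<in> {i..<i + m} \<Longrightarrow>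
          p = inner_label i (tree_root (restrict_block i m U))) \<Longrightarrow>
        energy U = energy (contract_block i m U) + energy (restrict_block i m U)"
proof -
  define S T where "S = contract_block i m U" and "T = restrict_block i m U"
  have tree: "is_wtree U" and len: "length (weights U) = n + m - 1"
    using U by (auto simp: wtrees_def)
  have V: "verts U = {1..n + m - 1}" and VS: "verts S = {1..n}" and VT: "verts T = {1..m}"
    using len m by (simp_all add: verts_def S_def T_def)
  have B: "{i..<i + m} \<subseteq> verts U"
    using i m by (auto simp: V)
  interpret subtree_contraction "verts U" "{i..<i + m}" "edges U" "collapse i m" i
      "inner_label i (tree_root (restrict_block i m U))"
    by (rule subtree_contraction_block[OF i m len is_wtree_parent_graph[OF tree] sub])
  note S_tree = contract_block_tree[OF i m len tree sub]
  have hS: "height S u = depth contracted (collapse i m (tree_root U)) u" for u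
    unfolding height_eq_depth[OF is_wtree_arborescence[OF S_tree(1)], folded S_def]
    by (simp add: S_def S_tree(2) edges_contract_block contracted_def)
  have hT: "height T x = depth (edges U \<inter> {i..<i + m} \<times> {i..<i + m})
      (inner_label i (tree_root (restrict_block i m U))) (inner_label i x)" if "x \<in> {1..m}" for x
    using depth_image[OF is_wtree_arborescence[OF sub] inj_on_inner_label[OF i(1)], of x] that
    unfolding edges_restrict_block[OF i(1)] T_def height_eq_depth[OF is_wtree_arborescence[OF sub]]
    by (simp add: restrict_block_def)
  have "energy S = (\<Sum>u\<in>{1..n}. \<Sum>v | v \<in> verts U \<and> collapse i m v = u.
      weight U v * height S (collapse i m v))"
    unfolding energy_def VS
  proof (rule sum.cong[OF refl])
    fix u assume "u \<in> {1..n}"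
    then show "weight S u * height S u =
        (\<Sum>v | v \<in> verts U \<and> collapse i m v = u. weight U v * height S (collapse i m v))"
      using len m by (simp add: S_def contract_block_def weight_push_tree sum_distrib_right)
  qed
  also have "\<dots> = (\<Sum>v\<in>verts U. weight U v * height S (collapse i m v))"
    by (rule sum.group) (use image_collapse[OF i m] V in auto)
  finally have eS: "energy S = (\<Sum>v\<in>verts U. weight U v * height S (collapse i m v))" .
  define hB where "hB v = depth (edges U \<inter> {i..<i + m} \<times> {i..<i + m})
      (inner_label i (tree_root (restrict_block i m U))) v" for v
  have "energy T = (\<Sum>x\<in>{1..m}. weight U (inner_label i x) * hB (inner_label i x))"
    unfolding energy_def VT hB_def
    by (intro sum.cong refl) (use hT in \<open>simp add: T_def restrict_block_def weight_pull_tree\<close>)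
  also have "\<dots> = (\<Sum>v\<in>inner_label i ` {1..m}. weight U v * hB v)"
    by (simp add: sum.reindex[OF inj_on_inner_label[OF i(1)]])
  also have "\<dots> = (\<Sum>v\<in>verts U. weight U v * (if v \<in> {i..<i + m} then hB v else 0))"
    unfolding image_inner_label[OF i(1)]
    by (rule sum.mono_neutral_cong_left) (use B in auto)
  finally have sum: "energy S + energy T = (\<Sum>v\<in>verts U. weight U v * split_depth (tree_root U) v)"
    unfolding eS hB_def split_depth_def by (simp add: sum.distrib distrib_left hS)
  note treeU = is_wtree_arborescence[OF tree]
  have "energy S + energy T \<le> energy U"
    unfolding sum unfolding energy_def height_eq_depth[OF treeU]
    by (intro sum_mono mult_le_mono2 split_depth_le[OF treeU])
  then show "energy (contract_block i m U) + energy (restrict_block i m U) \<le> energy U"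
    by (simp add: S_def T_def)
  assume entry: "\<And>v p. (v, p) \<in> edges U \<Longrightarrow> v \<notin> {i..<i + m} \<Longrightarrow> p \<in> {i..<i + m} \<Longrightarrow>
          p = inner_label i (tree_root (restrict_block i m U))"
  have "split_depth (tree_root U) v = depth (edges U) (tree_root U) v" if "v \<in> verts U" for v
    by (rule split_depth_eq[OF treeU that]) (rule entry)
  then have "energy U = energy S + energy T"
    unfolding sum unfolding energy_def height_eq_depth[OF treeU]
    by simp
  then show "energy U = energy (contract_block i m U) + energy (restrict_block i m U)"
    by (simp add: S_def T_def)
qed

lemma (in grafting) energy_graft_root:
  assumes w: "tree_weight T = weight S i" and root: "\<And>e. e \<in> in_edges S i \<Longrightarrow> f e = tree_root T"
  shows "energy G = energy S + energy T"
proof -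
  have "energy G = energy (contract_block i m G) + energy (restrict_block i m G)"
  proof (rule energy_contract_restrict_eq[OF i m graft_tree[OF w]])
    show "is_wtree (restrict_block i m G)"
      using restrict_graft trees by simp
    fix v p assume e: "(v, p) \<in> edges G" "v \<notin> {i..<i + m}" "p \<in> {i..<i + m}"
    from e(1) have "\<exists>c. (c, i) \<in> edges S \<and> p = inner_label i (f (c, i))"
      by (cases rule: graft_edge_cases)
        (use e(2,3) inner_in_block outer_notin_block in \<open>blast+\<close>)
    then show "p = inner_label i (tree_root (restrict_block i m G))"
      using root restrict_graft by (auto simp: in_edges_def)
  qed
  then show ?thesis
    using contract_graft[OF w] restrict_graft by simp
qed


section \<open>The operations in coordinates\<close>

lemma sum_fun_apply: "(\<Sum>f\<in>F. g f) U = (\<Sum>f\<in>F. g f U)"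
  for g :: "'a \<Rightarrow> 'b \<Rightarrow> 'k::comm_monoid_add"
  by (induction F rule: infinite_finite_induct) auto

lemma finite_in_edges: "is_wtree S \<Longrightarrow> finite (in_edges S i)"
  by (rule finite_subset[of _ "verts S \<times> verts S"]) (use is_wtree_edges in \<open>auto simp: in_edges_def\<close>)

text \<open>
  At most one \<open>f\<close> in the sum yields \<open>U\<close>. The condition on weights is implied by the condition
  on the right-hand side.
\<close>

lemma basis_comp_eval:
  assumes i: "1 \<le> i" "i \<le> n" and m: "1 \<le> m" and S: "S \<in> wtrees n" and T: "T \<in> wtrees m"
  shows "basis_comp lam i S T U =
    (if U \<in> wtrees (n + m - 1) \<and> contract_block i m U = S \<and> restrict_block i m U = T
     then lam ^ (energy U - energy S - energy T) else 0)" (is "_ = (if ?P then _ else _)")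
proof (cases "tree_weight T = weight S i")
  case False
  have "\<not> ?P"
    using weight_contract_block_inside[OF i m, of U] False by (auto simp: wtrees_def)
  then show ?thesis
    unfolding basis_comp_def using False by (simp only: if_False zero_fun_def)
next
  case w: True
  define F where "F = in_edges S i \<rightarrow>\<^sub>E verts T"
  have trees: "is_wtree S" "is_wtree T"
    using S T by (auto simp: wtrees_def)
  have g: "grafting i n m S T f" if "f \<in> F" for f
    by unfold_locales (use i S T that in \<open>auto simp: F_def\<close>)
  have root: "tree_root T \<in> verts T"
    by (rule arborescence_root_in[OF is_wtree_arborescence[OF trees(2)]])
  have g0: "grafting i n m S T (\<lambda>_. tree_root T)"
    by unfold_locales (use i S T root in auto)
  have "finite F"
    unfolding F_def by (intro finite_PiE finite_in_edges[OF trees(1)]) simp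
  have inj: "f = f'" if "f \<in> F" "f' \<in> F" "graft i f S T = graft i f' S T" for f f'
  proof (rule PiE_ext)
    show "f \<in> in_edges S i \<rightarrow>\<^sub>E verts T" "f' \<in> in_edges S i \<rightarrow>\<^sub>E verts T"
      using that by (simp_all add: F_def)
    show "f e = f' e" if "e \<in> in_edges S i" for e
      by (rule graft_inject[OF g g \<open>graft i f S T = graft i f' S T\<close> that]) fact+
  qed
  have "basis_comp lam i S T U =
      (\<Sum>f\<in>F. lam ^ (energy (graft i f S T) - (energy S + energy T)) * basis_tree (graft i f S T) U)"
    using w grafting.energy_graft_root[OF g0 w]
    by (simp add: basis_comp_def F_def sum_fun_apply tscale_def)
  also have "\<dots> = (if ?P then lam ^ (energy U - energy S - energy T) else 0)"
  proof (cases ?P)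
    case True
    then have "\<exists>f. grafting i n m S T f \<and> U = graft i f S T"
      using graft_contract_restrict[OF i m, of U] trees by blast
    then obtain f where f: "grafting i n m S T f" "U = graft i f S T"
      by blast
    \<comment> \<open>The graft only depends on the values of \<open>f\<close> on the edges arriving at \<open>i\<close>.\<close>
    define f' where "f' = restrict f (in_edges S i)"
    have f': "f' \<in> F"
      using grafting.f[OF f(1)] by (auto simp: F_def f'_def)
    have "{(outer_label i (length (weights T)) (fst e), inner_label i (f' e)) | e. e \<in> in_edges S i} =
        {(outer_label i (length (weights T)) (fst e), inner_label i (f e)) | e. e \<in> in_edges S i}"
      unfolding f'_def by (intro Collect_cong) auto
    then have Uf': "U = graft i f' S T"
      unfolding f(2) graft_def Let_def by simp
    have "lam ^ (energy (graft i h S T) - (energy S + energy T)) * basis_tree (graft i h S T) U =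
        (if h = f' then lam ^ (energy U - energy S - energy T) else 0)" if "h \<in> F" for h
      using inj[OF that f'] Uf' by (auto simp: basis_tree_def)
    then show ?thesis
      using True \<open>finite F\<close> f' by (simp add: sum.delta cong: sum.cong)
  next
    case False
    have "basis_tree (graft i f S T) U = (0 :: 'a)" if "f \<in> F" for f
      using False grafting.graft_tree[OF g[OF that] w] grafting.contract_graft[OF g[OF that] w]
        grafting.restrict_graft[OF g[OF that]] by (auto simp: basis_tree_def)
    then show ?thesis
      unfolding if_not_P[OF False] by simp
  qed
  finally show ?thesis .
qed

lemma tree_comp_eval:
  assumes i: "1 \<le> i" "i \<le> n" and m: "1 \<le> m"
  shows "tree_comp lam n m i x y U =
    (if U \<in> wtrees (n + m - 1) \<and> is_wtree (restrict_block i m U)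
     then lam ^ (energy U - energy (contract_block i m U) - energy (restrict_block i m U)) *
       (x (contract_block i m U) * y (restrict_block i m U))
     else 0)" (is "_ = (if ?P then _ else _)")
proof (cases ?P)
  case True
  define S T where "S = contract_block i m U" and "T = restrict_block i m U"
  have S: "S \<in> wtrees n" and T: "T \<in> wtrees m"
    using contract_block_tree[OF i m, of U] True m by (auto simp: wtrees_def S_def T_def)
  have "tree_comp lam n m i x y U = (\<Sum>(S, T)\<in>{(S, T)}. x S * y T * basis_comp lam i S T U)"
    unfolding tree_comp_def
  proof (rule sum.mono_neutral_cong_left)
    show "{(S', T'). S' \<in> wtrees n \<and> T' \<in> wtrees m \<and> basis_comp lam i S' T' U \<noteq> 0} \<subseteq> {(S, T)}"
      by (auto simp: basis_comp_eval[OF i m] S_def T_def split: if_splits)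
  qed (use S T in auto)
  also have "\<dots> = lam ^ (energy U - energy S - energy T) * (x S * y T)"
    using basis_comp_eval[OF i m S T, of lam U] True by (simp add: S_def T_def)
  finally show ?thesis
    using True by (simp add: S_def T_def)
next
  case False
  have zero: "basis_comp lam i S T U = 0" if "S \<in> wtrees n" "T \<in> wtrees m" for S T
  proof -
    have "is_wtree T"
      using that by (simp add: wtrees_def)
    then have "\<not> (U \<in> wtrees (n + m - 1) \<and> contract_block i m U = S \<and> restrict_block i m U = T)"
      using False by blast
    then show ?thesis
      unfolding basis_comp_eval[OF i m that] by (rule if_not_P)
  qed
  have "tree_comp lam n m i x y U = 0"
    unfolding tree_comp_def by (rule sum.neutral) (use zero in auto)
  then show ?thesis
    using False by (simp only: if_False)
qed

lemma tree_act_eval: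
  assumes \<sigma>: "\<sigma> permutes {1..n}"
  shows "tree_act n x \<sigma> U = (if U \<in> wtrees n then x (relabel U (inv \<sigma>)) else 0)"
proof (cases "U \<in> wtrees n")
  case True
  have "{T. T \<in> wtrees n \<and> relabel T \<sigma> = U} = {relabel U (inv \<sigma>)}"
    using True relabel_in_wtrees[OF True permutes_inv[OF \<sigma>]] relabel_inv[OF _ _ \<sigma>]
    by (auto simp: wtrees_def)
  then show ?thesis
    using True by (simp add: tree_act_def)
next
  case False
  then have "{T. T \<in> wtrees n \<and> relabel T \<sigma> = U} = {}"
    using relabel_in_wtrees[OF _ \<sigma>] by auto
  then show ?thesis
    unfolding tree_act_def using False by (simp only: sum.empty if_False)
qed

lemma tree_act_relabel:
  assumes "\<sigma> permutes {1..n}" "T \<in> wtrees n"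
  shows "tree_act n x \<sigma> (relabel T \<sigma>) = x T"
  using tree_act_eval[OF assms(1), of x "relabel T \<sigma>"] relabel_in_wtrees[OF assms(2,1)] relabel_inv(1)[OF _ _ assms(1), of T] assms(2)
  by (simp add: wtrees_def)

lemma wtrees_1: "U \<in> wtrees 1 \<longleftrightarrow> (\<exists>k\<ge>1. U = WTree [k] {})"
proof
  assume "U \<in> wtrees 1"
  then have tree: "is_wtree U" and len: "length (weights U) = 1"
    by (auto simp: wtrees_def)
  then have V: "verts U = {1}"
    by (simp add: verts_def)
  have "edges U = {}"
    using is_wtree_edges[OF tree] is_wtree_irrefl[OF tree, of 1] unfolding V by auto
  moreover obtain k where k: "weights U = [k]"
    using len by (auto simp: length_Suc_conv)
  moreover have "1 \<le> k"
    using is_wtree_weight[OF tree, of 1] k by (simp add: V weight_def)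
  ultimately show "\<exists>k\<ge>1. U = WTree [k] {}"
    by (cases U) auto
next
  assume "\<exists>k\<ge>1. U = WTree [k] {}"
  then show "U \<in> wtrees 1"
    by (auto simp: wtrees_def is_wtree_def verts_def weight_def)
qed

lemma tree_unit_eq: "tree_unit U = (if U \<in> wtrees 1 then 1 else 0)"
  using wtrees_1[of U] by (auto simp: tree_unit_def)


section \<open>The homogeneous components\<close>

interpretation tree_space: vector_space tscale
  by unfold_locales (auto simp: tscale_def fun_eq_iff algebra_simps)

text \<open>There are finitely many trees of a given multidegree, so all functions on them are in the span.\<close>

lemma tree_Gr_eq: "tree_Gr a = {x. \<forall>U. x U \<noteq> 0 \<longrightarrow> is_wtree U \<and> weights U = a}" (is "_ = ?R")
proof
  have "basis_tree T \<in> ?R" if "is_wtree T" "weights T = a" for T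
    using that by (auto simp: basis_tree_def)
  moreover have "tree_space.subspace ?R"
  proof (rule tree_space.subspaceI)
    show "x + y \<in> ?R" if "x \<in> ?R" "y \<in> ?R" for x y :: "wtree \<Rightarrow> 'a"
    proof -
      have "x U \<noteq> 0 \<or> y U \<noteq> 0" if "(x + y) U \<noteq> 0" for U
        using that by auto
      then show ?thesis
        using that by blast
    qed
  qed (auto simp: tscale_def)
  ultimately show "tree_Gr a \<subseteq> ?R"
    unfolding tree_Gr_def by (intro tree_space.span_minimal) auto
  show "?R \<subseteq> tree_Gr a"
  proof
    fix x :: "wtree \<Rightarrow> 'a" assume x: "x \<in> ?R"
    define A where "A = {T. is_wtree T \<and> weights T = a}"
    have fin: "finite A"
      unfolding A_def by (rule finite_wtrees_weights)
    have "x = (\<Sum>T\<in>A. tscale (x T) (basis_tree T))"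
    proof
      fix U
      have "(\<Sum>T\<in>A. tscale (x T) (basis_tree T)) U = (\<Sum>T\<in>A. if T = U then x T else 0)"
        unfolding sum_fun_apply by (intro sum.cong refl) (auto simp: tscale_def basis_tree_def)
      also have "\<dots> = (if U \<in> A then x U else 0)"
        using fin by (simp add: sum.delta)
      also have "\<dots> = x U"
        using x by (auto simp: A_def)
      finally show "x U = (\<Sum>T\<in>A. tscale (x T) (basis_tree T)) U"
        by simp
    qed
    also have "\<dots> \<in> tree_Gr a"
      unfolding tree_Gr_def
      by (intro tree_space.span_sum tree_space.span_scale tree_space.span_base) (auto simp: A_def)
    finally show "x \<in> tree_Gr a" .
  qed
qed

lemma tree_Op_eq: "tree_Op n = {x. \<forall>U. U \<notin> wtrees n \<longrightarrow> x U = 0}"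
  unfolding tree_Op_def tree_Gr_eq tree_proj_def by (auto simp: wtrees_def)

lemma weights_in_multidegrees:
  assumes "T \<in> wtrees n"
  shows "weights T \<in> multidegrees n"
proof -
  have "1 \<le> weights T ! k" if "k < n" for k
    using is_wtree_weight[of T "Suc k"] assms that by (auto simp: weight_def verts_def wtrees_def)
  then show ?thesis
    using assms by (auto simp: multidegrees_def wtrees_def in_set_conv_nth)
qed

lemma tree_Gr_subset: "a \<in> multidegrees n \<Longrightarrow> tree_Gr a \<subseteq> tree_Op n"
  by (auto simp: tree_Gr_eq tree_Op_eq wtrees_def multidegrees_def)

lemma tree_sum_list: "tree_weight T = sum_list (weights T)"
  unfolding tree_weight_def sum_list_sum_nth verts_def weight_def
  by (rule sum.reindex_bij_witness[of _ Suc "\<lambda>v. v - 1"]) auto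

lemma weights_eq_insert_degree:
  assumes "1 \<le> i" "i \<le> n" "1 \<le> m" "U \<in> wtrees (n + m - 1)" "is_wtree (restrict_block i m U)"
  shows "weights U = insert_degree i (weights (contract_block i m U)) (weights (restrict_block i m U))"
proof -
  obtain f where "U = graft i f (contract_block i m U) (restrict_block i m U)"
    using graft_contract_restrict[OF assms] by blast
  from arg_cong[OF this, of weights] show ?thesis
    by (simp only: graft_def Let_def wtree.sel)
qed

lemma length_perm_degree [simp]: "length (perm_degree a \<sigma>) = length a"
  by (simp add: perm_degree_def del: upt_Suc)

lemma nth_perm_degree:
  "k \<in> {1..n} \<Longrightarrow> length a = n \<Longrightarrow> perm_degree a \<sigma> ! (k - 1) = a ! (\<sigma> k - 1)"
  by (simp only: perm_degree_def nth_map_upt_Suc)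

lemma perm_degree_inv:
  assumes \<sigma>: "\<sigma> permutes {1..n}" and a: "length a = n"
  shows "perm_degree (perm_degree a \<sigma>) (inv \<sigma>) = a"
proof (rule nth_equalityI)
  show "length (perm_degree (perm_degree a \<sigma>) (inv \<sigma>)) = length a"
    by simp
  fix k assume "k < length (perm_degree (perm_degree a \<sigma>) (inv \<sigma>))"
  then have k: "Suc k \<in> {1..n}"
    using a by simp
  then have k': "inv \<sigma> (Suc k) \<in> {1..n}"
    using permutes_in_image[OF permutes_inv[OF \<sigma>]] by blast
  have "perm_degree (perm_degree a \<sigma>) (inv \<sigma>) ! (Suc k - 1) = perm_degree a \<sigma> ! (inv \<sigma> (Suc k) - 1)"
    by (rule nth_perm_degree[OF k]) (simp add: a)
  also have "\<dots> = a ! (\<sigma> (inv \<sigma> (Suc k)) - 1)"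
    by (rule nth_perm_degree[OF k' a])
  also have "\<dots> = a ! k"
    using permutes_inverses(1)[OF \<sigma>] by simp
  finally show "perm_degree (perm_degree a \<sigma>) (inv \<sigma>) ! k = a ! k"
    by simp
qed

lemma tree_act_closed:
  assumes "\<sigma> permutes {1..n}"
  shows "tree_act n x \<sigma> \<in> tree_Op n"
  by (simp add: tree_Op_eq tree_act_eval[OF assms])

lemma tree_act_act:
  assumes "\<sigma> permutes {1..n}" "\<tau> permutes {1..n}"
  shows "tree_act n (tree_act n x \<sigma>) \<tau> = tree_act n x (\<sigma> \<circ> \<tau>)"
proof
  fix U
  have "relabel (relabel U (inv \<tau>)) (inv \<sigma>) = relabel U (inv (\<sigma> \<circ> \<tau>))" if "U \<in> wtrees n"
  proof -
    have "inv (\<sigma> \<circ> \<tau>) = inv \<tau> \<circ> inv \<sigma>"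
      by (rule o_inv_distrib) (use assms permutes_bij in auto)
    then show ?thesis
      using that relabel_relabel[OF _ _ permutes_inv[OF assms(2)] permutes_inv[OF assms(1)]]
      by (simp add: wtrees_def)
  qed
  then show "tree_act n (tree_act n x \<sigma>) \<tau> U = tree_act n x (\<sigma> \<circ> \<tau>) U"
    using relabel_in_wtrees[OF _ permutes_inv[OF assms(2)]]
    by (simp add: tree_act_eval[OF assms(1)] tree_act_eval[OF assms(2)]
        tree_act_eval[OF permutes_compose[OF assms(2,1)]])
qed

lemma tree_act_Gr:
  assumes \<sigma>: "\<sigma> permutes {1..n}" and a: "a \<in> multidegrees n" and x: "x \<in> tree_Gr a"
  shows "tree_act n x \<sigma> \<in> tree_Gr (perm_degree a \<sigma>)"
proof -
  have "is_wtree U \<and> weights U = perm_degree a \<sigma>" if nz: "tree_act n x \<sigma> U \<noteq> 0" for U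
  proof -
    have U: "U \<in> wtrees n" and "x (relabel U (inv \<sigma>)) \<noteq> 0"
      using nz by (auto simp: tree_act_eval[OF \<sigma>] split: if_splits)
    then have "weights (relabel U (inv \<sigma>)) = a"
      using x by (auto simp: tree_Gr_eq)
    moreover have "U = relabel (relabel U (inv \<sigma>)) \<sigma>"
      using U relabel_inv(2)[OF _ _ \<sigma>] by (simp add: wtrees_def)
    ultimately have "weights U = perm_degree a \<sigma>"
      by (metis relabel_def wtree.sel(1))
    then show ?thesis
      using U by (simp add: wtrees_def)
  qed
  then show ?thesis
    by (simp add: tree_Gr_eq)
qed

lemma perm_degree_multidegrees:
  assumes \<sigma>: "\<sigma> permutes {1..n}" and a: "a \<in> multidegrees n"
  shows "perm_degree a \<sigma> \<in> multidegrees n"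
proof -
  have "a ! (\<sigma> k - 1) \<in> set a" if "k \<in> {1..n}" for k
    using permutes_1_bounds[OF \<sigma>, of k] that a by (intro nth_mem) (auto simp: multidegrees_def)
  then show ?thesis
    using a by (auto simp: multidegrees_def perm_degree_def)
qed

lemma tree_Gr_act:
  assumes \<sigma>: "\<sigma> permutes {1..n}" and a: "a \<in> multidegrees n"
  shows "(\<lambda>x. tree_act n x \<sigma>) ` tree_Gr a = (tree_Gr (perm_degree a \<sigma>) :: (wtree \<Rightarrow> 'k::field) set)"
proof
  show "(\<lambda>x. tree_act n x \<sigma>) ` tree_Gr a \<subseteq> (tree_Gr (perm_degree a \<sigma>) :: (wtree \<Rightarrow> 'k) set)"
    using tree_act_Gr[OF \<sigma> a] by blast
  show "tree_Gr (perm_degree a \<sigma>) \<subseteq> (\<lambda>x. tree_act n x \<sigma>) ` (tree_Gr a :: (wtree \<Rightarrow> 'k) set)"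
  proof
    fix y :: "wtree \<Rightarrow> 'k" assume y: "y \<in> tree_Gr (perm_degree a \<sigma>)"
    note a' = perm_degree_multidegrees[OF \<sigma> a]
    have "tree_act n y (inv \<sigma>) \<in> tree_Gr a"
      using tree_act_Gr[OF permutes_inv[OF \<sigma>] a' y] perm_degree_inv[OF \<sigma>] a
      by (simp add: multidegrees_def)
    moreover have "y \<in> tree_Op n"
      using tree_Gr_subset[OF a'] y by blast
    then have "y = tree_act n y id"
      by (auto simp: fun_eq_iff tree_act_eval[OF permutes_id] tree_Op_eq wtrees_def relabel_id)
    then have "y = tree_act n (tree_act n y (inv \<sigma>)) \<sigma>"
      by (simp add: tree_act_act[OF permutes_inv[OF \<sigma>] \<sigma>] permutes_inv_o[OF \<sigma>])
    ultimately show "y \<in> (\<lambda>x. tree_act n x \<sigma>) ` tree_Gr a"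
      by blast
  qed
qed

lemma tree_Op_product:
  "bij_betw (\<lambda>x. \<lambda>a\<in>multidegrees n. tree_proj a x) (tree_Op n)
     (\<Pi>\<^sub>E a\<in>multidegrees n. (tree_Gr a :: (wtree \<Rightarrow> 'k::field) set))"
proof (rule bij_betw_byWitness[where f' = "\<lambda>g U. if U \<in> wtrees n then g (weights U) U else 0"])
  show "\<forall>x\<in>tree_Op n. (\<lambda>U. if U \<in> wtrees n
      then (\<lambda>a\<in>multidegrees n. tree_proj a x) (weights U) U else (0 :: 'k)) = x"
    by (auto simp: fun_eq_iff tree_Op_eq tree_proj_def weights_in_multidegrees)
  show "\<forall>g\<in>\<Pi>\<^sub>E a\<in>multidegrees n. tree_Gr a. (\<lambda>a\<in>multidegrees n.
      tree_proj a (\<lambda>U. if U \<in> wtrees n then g (weights U) U else (0 :: 'k))) = g"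
  proof
    fix g :: "nat list \<Rightarrow> wtree \<Rightarrow> 'k" assume g: "g \<in> (\<Pi>\<^sub>E a\<in>multidegrees n. tree_Gr a)"
    have "tree_proj a (\<lambda>U. if U \<in> wtrees n then g (weights U) U else 0) = g a"
      if a: "a \<in> multidegrees n" for a
    proof
      fix U
      have "g a \<in> tree_Gr a"
        using g a by blast
      then have "g a U \<noteq> 0 \<Longrightarrow> is_wtree U \<and> weights U = a"
        by (simp add: tree_Gr_eq)
      then show "tree_proj a (\<lambda>U. if U \<in> wtrees n then g (weights U) U else 0) U = g a U"
        using a by (auto simp: tree_proj_def wtrees_def multidegrees_def)
    qed
    then show "(\<lambda>a\<in>multidegrees n. tree_proj a (\<lambda>U. if U \<in> wtrees n then g (weights U) U else 0)) = g"
      using PiE_arb[OF g] by (auto simp: restrict_def fun_eq_iff)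
  qed
  show "(\<lambda>x. \<lambda>a\<in>multidegrees n. tree_proj a x) ` tree_Op n \<subseteq>
      (\<Pi>\<^sub>E a\<in>multidegrees n. (tree_Gr a :: (wtree \<Rightarrow> 'k) set))"
    by (auto simp: tree_Op_def)
  show "(\<lambda>g U. if U \<in> wtrees n then g (weights U) U else (0 :: 'k)) `
      (\<Pi>\<^sub>E a\<in>multidegrees n. tree_Gr a) \<subseteq> tree_Op n"
    by (auto simp: tree_Op_eq)
qed

lemma tree_comp_nonzero:
  assumes "1 \<le> i" "i \<le> n" "1 \<le> m" and nz: "tree_comp lam n m i x y U \<noteq> 0"
  shows "U \<in> wtrees (n + m - 1)" "is_wtree (restrict_block i m U)"
    and "x (contract_block i m U) \<noteq> 0" "y (restrict_block i m U) \<noteq> 0"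
  using nz by (auto simp: tree_comp_eval[OF assms(1-3)] split: if_splits)

lemma tree_comp_Gr:
  assumes "1 \<le> i" "i \<le> n" "1 \<le> m" "x \<in> tree_Gr a" "y \<in> tree_Gr b"
  shows "tree_comp lam n m i x y \<in> tree_Gr (insert_degree i a b)"
  unfolding tree_Gr_eq
proof (intro CollectI allI impI)
  fix U assume "tree_comp lam n m i x y U \<noteq> 0"
  note nz = tree_comp_nonzero[OF assms(1-3) this]
  have "weights (contract_block i m U) = a" "weights (restrict_block i m U) = b"
    using nz(3,4) assms(4,5) by (auto simp: tree_Gr_eq)
  then show "is_wtree U \<and> weights U = insert_degree i a b"
    using weights_eq_insert_degree[OF assms(1-3) nz(1,2)] nz(1) by (simp add: wtrees_def)
qed

lemma tree_comp_Gr_zero: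
  assumes "1 \<le> i" "i \<le> n" "1 \<le> m" "x \<in> tree_Gr a" "y \<in> tree_Gr b"
    and "sum_list b \<noteq> a ! (i - 1)"
  shows "tree_comp lam n m i x y = 0"
proof
  fix U
  have False if "tree_comp lam n m i x y U \<noteq> 0"
  proof -
    note nz = tree_comp_nonzero[OF assms(1-3) that]
    have "weights (contract_block i m U) = a" "weights (restrict_block i m U) = b"
      using nz(3,4) assms(4,5) by (auto simp: tree_Gr_eq)
    then show False
      using weight_contract_block_inside[OF assms(1-3), of U] nz(1) assms(6)
      by (simp add: tree_sum_list weight_def wtrees_def)
  qed
  then show "tree_comp lam n m i x y U = 0 U"
    by auto
qed


section \<open>The operad axioms\<close>

text \<open>
  Write \<open>C \<subseteq> B\<close> for the two blocks of \<open>U\<close>. Both sides evaluate \<open>x\<close> at \<open>S = U/B\<close>, \<open>y\<close> at \<open>T = (U|B)/C\<close>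
  and \<open>z\<close> at \<open>U|C\<close>; the energies of the intermediate trees \<open>Q = U/C\<close> and \<open>U|B\<close> cancel.
\<close>

lemma tree_comp_nested:
  assumes "1 \<le> i" "i \<le> n" "1 \<le> j" "j \<le> m" "1 \<le> p"
  shows "tree_comp lam (n + m - 1) p (i - 1 + j) (tree_comp lam n m i x y) z =
    tree_comp lam n (m + p - 1) i x (tree_comp lam m p j y z)" (is "?L = ?R")
proof
  fix U
  define Q C B where "Q = contract_block (i - 1 + j) p U" and "C = restrict_block (i - 1 + j) p U"
    and "B = restrict_block i (m + p - 1) U"
  have m: "1 \<le> m" and ij: "1 \<le> i - 1 + j" "i - 1 + j \<le> n + m - 1" and mp: "1 \<le> m + p - 1"
    and N: "n + m - 1 + p - 1 = n + m + p - 2" "n + (m + p - 1) - 1 = n + m + p - 2"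
    using assms by auto
  note L = tree_comp_eval[OF ij assms(5), of lam "tree_comp lam n m i x y" z U, folded Q_def C_def, unfolded N]
  note R = tree_comp_eval[OF assms(1,2) mp, of lam x "tree_comp lam m p j y z" U, folded B_def, unfolded N]
  show "?L U = ?R U"
  proof (cases "U \<in> wtrees (n + m + p - 2)")
    case False
    then show ?thesis
      unfolding L R by simp
  next
    case True
    then have tree: "is_wtree U" and len: "length (weights U) = n + m + p - 2"
      by (auto simp: wtrees_def)
    have lens: "length (weights U) = n + m - 1 + p - 1" "length (weights U) = n + (m + p - 1) - 1"
      using len N by simp_all
    note graph = is_wtree_parent_graph[OF tree]
    define S T where "S = contract_block i m Q" and "T = restrict_block i m Q"
    have S: "contract_block i (m + p - 1) U = S"
      unfolding S_def Q_def by (rule contract_contract_nested[OF assms len, symmetric])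
    have T: "contract_block j p B = T"
      unfolding T_def Q_def B_def by (rule restrict_contract_nested[OF assms len graph, symmetric])
    have C: "restrict_block j p B = C"
      unfolding B_def C_def by (rule restrict_restrict_nested[OF assms(1,3-5)])
    note LQ = tree_comp_eval[OF assms(1,2) m, of lam x y Q, folded S_def T_def]
    note RB = tree_comp_eval[OF assms(3-5), of lam y z B, unfolded T C]
    have lenB: "length (weights B) = m + p - 1"
      by (simp add: B_def)
    show ?thesis
    proof (cases "is_wtree C")
      case False
      have "?L U = 0"
        unfolding L using False by simp
      moreover have "?R U = 0"
        unfolding R RB using False by simp
      ultimately show ?thesis
        by simp
    next
      case Ctree: True
      have Q: "Q \<in> wtrees (n + m - 1)"
        using contract_block_tree(1)[OF ij assms(5) lens(1) tree] Ctree len assms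
        by (simp add: wtrees_def Q_def C_def)
      have Bgraph: "parent_graph B"
        unfolding B_def by (rule parent_graph_restrict_block[OF graph assms(1)]) (use len assms in simp)
      have BT: "is_wtree B \<longleftrightarrow> is_wtree T"
        using is_wtree_iff_contract_block[OF assms(3-5) lenB Bgraph] C T Ctree by simp
      show ?thesis
      proof (cases "is_wtree T")
        case False
        have "?L U = 0"
          unfolding L LQ using False by simp
        moreover have "?R U = 0"
          unfolding R using False BT by simp
        ultimately show ?thesis
          by simp
      next
        case Ttree: True
        then have Btree: "is_wtree B"
          using BT by simp
        then have B: "B \<in> wtrees (m + p - 1)"
          using lenB by (simp add: wtrees_def)
        have "energy Q + energy C \<le> energy U"
          using energy_contract_restrict_le[OF ij assms(5), of U] True Ctree N
          by (simp add: Q_def C_def)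
        moreover have "energy S + energy T \<le> energy Q"
          using energy_contract_restrict_le[OF assms(1,2) m Q] Ttree by (simp add: S_def T_def)
        moreover have "energy S + energy B \<le> energy U"
          using energy_contract_restrict_le[OF assms(1,2) mp, of U, unfolded S N, folded B_def]
            True Btree by blast
        moreover have "energy T + energy C \<le> energy B"
          using energy_contract_restrict_le[OF assms(3-5) B] Ctree by (simp add: T C)
        ultimately have exps: "(energy U - energy Q - energy C) + (energy Q - energy S - energy T) =
            (energy U - energy S - energy B) + (energy B - energy T - energy C)"
          by simp
        have "?L U = lam ^ (energy U - energy Q - energy C) * lam ^ (energy Q - energy S - energy T) *
            (x S * y T * z C)"
          unfolding L LQ using True Ctree Q Ttree by simp
        also have "\<dots> = lam ^ (energy U - energy S - energy B) * lam ^ (energy B - energy T - energy C) *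
            (x S * y T * z C)"
          unfolding power_add[symmetric] exps ..
        also have "\<dots> = ?R U"
          unfolding R RB S using True Ctree B Btree by simp
        finally show ?thesis .
      qed
    qed
  qed
qed

text \<open>Here the intermediate trees \<open>Q\<close> and \<open>P\<close> are the contractions of one of the two disjoint blocks,
  and again their energies cancel.\<close>

lemma tree_comp_disjoint:
  assumes "1 \<le> i" "i < k" "k \<le> n" "1 \<le> m" "1 \<le> p"
  shows "tree_comp lam (n + m - 1) p (k - 1 + m) (tree_comp lam n m i x y) z =
    tree_comp lam (n + p - 1) m i (tree_comp lam n p k x z) y" (is "?L = ?R")
proof
  fix U
  define Q P C B where "Q = contract_block (k - 1 + m) p U" and "P = contract_block i m U"
    and "C = restrict_block (k - 1 + m) p U" and "B = restrict_block i m U"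
  have i: "i \<le> n" "i \<le> n + p - 1" and k: "1 \<le> k" "1 \<le> k - 1 + m" "k - 1 + m \<le> n + m - 1"
    and N: "n + m - 1 + p - 1 = n + m + p - 2" "n + p - 1 + m - 1 = n + m + p - 2"
    using assms by auto
  note L = tree_comp_eval[OF k(2,3) assms(5), of lam "tree_comp lam n m i x y" z U,
      folded Q_def C_def, unfolded N]
  note R = tree_comp_eval[OF assms(1) i(2) assms(4), of lam "tree_comp lam n p k x z" y U,
      folded P_def B_def, unfolded N]
  show "?L U = ?R U"
  proof (cases "U \<in> wtrees (n + m + p - 2)")
    case False
    then show ?thesis
      unfolding L R by simp
  next
    case True
    then have tree: "is_wtree U" and len: "length (weights U) = n + m + p - 2"
      by (auto simp: wtrees_def)
    have lens: "length (weights U) = n + m - 1 + p - 1" "length (weights U) = n + p - 1 + m - 1"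
      using len N by simp_all
    note graph = is_wtree_parent_graph[OF tree]
    define S where "S = contract_block i m Q"
    have S: "contract_block k p P = S"
      unfolding S_def Q_def P_def by (rule contract_contract_disjoint[OF assms len, symmetric])
    have B: "restrict_block i m Q = B" and C: "restrict_block k p P = C"
      unfolding Q_def P_def B_def C_def
      by (rule restrict_contract_disjoint[OF assms len graph])+
    note LQ = tree_comp_eval[OF assms(1) i(1) assms(4), of lam x y Q, folded S_def, unfolded B]
    note RP = tree_comp_eval[OF k(1) assms(3,5), of lam x z P, unfolded S C]
    show ?thesis
    proof (cases "is_wtree C \<and> is_wtree B")
      case False
      have "?L U = 0"
        unfolding L LQ using False by auto
      moreover have "?R U = 0"
        unfolding R RP using False by auto
      ultimately show ?thesis
        by simp
    next
      case trees: True
      have Q: "Q \<in> wtrees (n + m - 1)"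
        using contract_block_tree(1)[OF k(2,3) assms(5) lens(1) tree] trees len assms
        by (simp add: wtrees_def Q_def C_def)
      have P: "P \<in> wtrees (n + p - 1)"
        using contract_block_tree(1)[OF assms(1) i(2) assms(4) lens(2) tree] trees len assms
        by (simp add: wtrees_def P_def B_def)
      have "energy Q + energy C \<le> energy U"
        using energy_contract_restrict_le[OF k(2,3) assms(5), of U] True trees N
        by (simp add: Q_def C_def)
      moreover have "energy S + energy B \<le> energy Q"
        using energy_contract_restrict_le[OF assms(1) i(1) assms(4) Q] trees B by (simp add: S_def)
      moreover have "energy P + energy B \<le> energy U"
        using energy_contract_restrict_le[OF assms(1) i(2) assms(4), of U] True trees N
        by (simp add: P_def B_def)
      moreover have "energy S + energy C \<le> energy P"
        using energy_contract_restrict_le[OF k(1) assms(3,5) P] trees by (simp add: S C)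
      ultimately have exps: "(energy U - energy Q - energy C) + (energy Q - energy S - energy B) =
          (energy U - energy P - energy B) + (energy P - energy S - energy C)"
        by simp
      have "?L U = lam ^ (energy U - energy Q - energy C) * lam ^ (energy Q - energy S - energy B) *
          (x S * y B * z C)"
        unfolding L LQ using True trees Q by simp
      also have "\<dots> = lam ^ (energy U - energy P - energy B) * lam ^ (energy P - energy S - energy C) *
          (x S * y B * z C)"
        unfolding power_add[symmetric] exps ..
      also have "\<dots> = ?R U"
        unfolding R RP using True trees P by simp
      finally show ?thesis .
    qed
  qed
qed

text \<open>For \<open>U = W.\<rho>\<close>, the blocks of \<open>U\<close> and \<open>W\<close> correspond, and relabelling preserves energies.\<close>

lemma tree_comp_equivariant:
  assumes "1 \<le> i" "i \<le> n" "1 \<le> m" "\<sigma> permutes {1..n}" "\<tau> permutes {1..m}"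
  shows "tree_comp lam n m i (tree_act n x \<sigma>) (tree_act m y \<tau>) =
    tree_act (n + m - 1) (tree_comp lam n m (\<sigma> i) x y) (perm_comp n m i \<sigma> \<tau>)" (is "?L = ?R")
proof
  fix U
  define \<rho> where "\<rho> = perm_comp n m i \<sigma> \<tau>"
  have \<rho>: "\<rho> permutes {1..n + m - 1}"
    unfolding \<rho>_def by (rule perm_comp_permutes[OF assms])
  have \<sigma>i: "1 \<le> \<sigma> i" "\<sigma> i \<le> n"
    using permutes_1_bounds[OF assms(4,1,2)] .
  note L = tree_comp_eval[OF assms(1-3), of lam "tree_act n x \<sigma>" "tree_act m y \<tau>" U]
  note R = tree_act_eval[OF \<rho>, of "tree_comp lam n m (\<sigma> i) x y" U]
  show "?L U = ?R U"
  proof (cases "U \<in> wtrees (n + m - 1)")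
    case False
    then show ?thesis
      unfolding \<rho>_def[symmetric] L R by simp
  next
    case True
    then have tree: "is_wtree U" and len: "length (weights U) = n + m - 1"
      by (auto simp: wtrees_def)
    define W where "W = relabel U (inv \<rho>)"
    have W: "W \<in> wtrees (n + m - 1)"
      unfolding W_def by (rule relabel_in_wtrees[OF True permutes_inv[OF \<rho>]])
    then have Wtree: "is_wtree W" and Wlen: "length (weights W) = n + m - 1"
      by (auto simp: wtrees_def)
    have U: "U = relabel W \<rho>"
      unfolding W_def using relabel_inv(2)[OF tree len \<rho>] by simp
    define S T where "S = contract_block (\<sigma> i) m W" and "T = restrict_block (\<sigma> i) m W"
    have cU: "contract_block i m U = relabel S \<sigma>" and rU: "restrict_block i m U = relabel T \<tau>"
      unfolding U \<rho>_def S_def T_def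
      by (rule contract_relabel[OF assms Wtree Wlen] restrict_relabel[OF assms Wtree Wlen])+
    note RW = tree_comp_eval[OF \<sigma>i assms(3), of lam x y W, folded S_def T_def]
    have lenT: "length (weights T) = m"
      by (simp add: T_def)
    have "(v, v) \<notin> edges T" for v
      using is_wtree_irrefl[OF Wtree] by (auto simp: T_def restrict_block_def edges_pull_tree)
    note T_iff = is_wtree_relabel_iff[OF assms(5) lenT this]
    have "?R U = tree_comp lam n m (\<sigma> i) x y W"
      unfolding \<rho>_def[symmetric] R using True by (simp add: W_def)
    also have "\<dots> = ?L U"
    proof (cases "is_wtree T")
      case False
      then show ?thesis
        unfolding L RW rU T_iff by simp
    next
      case Ttree: True
      have Stree: "is_wtree S" and lenS: "length (weights S) = n"
        using contract_block_tree(1)[OF \<sigma>i assms(3) Wlen Wtree] Ttree Wlen assms(3)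
        by (simp_all add: S_def T_def)
      have "tree_act n x \<sigma> (relabel S \<sigma>) = x S" "tree_act m y \<tau> (relabel T \<tau>) = y T"
        using tree_act_relabel[OF assms(4), of S x] tree_act_relabel[OF assms(5), of T y]
          Stree lenS Ttree lenT by (simp_all add: wtrees_def)
      moreover have "energy U = energy W" "energy (relabel S \<sigma>) = energy S" "energy (relabel T \<tau>) = energy T"
        unfolding U using is_wtree_relabel(3)[OF Wtree Wlen \<rho>]
          is_wtree_relabel(3)[OF Stree lenS assms(4)] is_wtree_relabel(3)[OF Ttree lenT assms(5)] by simp_all
      ultimately show ?thesis
        unfolding L RW cU rU T_iff using True W Ttree by simp
    qed
    finally show ?thesis
      by simp
  qed
qed

lemma tree_unit_left:
  assumes "1 \<le> n" "x \<in> tree_Op n"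
  shows "tree_comp lam 1 n 1 tree_unit x = x"
proof
  fix U
  show "tree_comp lam 1 n 1 tree_unit x U = x U"
  proof (cases "U \<in> wtrees n")
    case False
    then show ?thesis
      using assms tree_comp_eval[of 1 1 n lam tree_unit x U] by (simp add: tree_Op_eq)
  next
    case True
    then have tree: "is_wtree U" and len: "length (weights U) = n"
      by (auto simp: wtrees_def)
    have "restrict_block 1 n U = pull_tree n id U"
      unfolding restrict_block_def by (rule pull_cong) (simp add: inner_label_def)
    then have r: "restrict_block 1 n U = U"
      using pull_id[OF is_wtree_edges[OF tree] len] by simp
    have c: "contract_block 1 n U \<in> wtrees 1"
      using contract_block_tree(1)[of 1 1 n U] tree len r assms by (simp add: wtrees_def)
    \<comment> \<open>The inequality \<open>d(U/B) + d(U|B) \<le> d(U)\<close> with \<open>U|B = U\<close>.\<close>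
    have "energy (contract_block 1 n U) = 0"
      using energy_contract_restrict_le[of 1 1 n U] True tree r assms by simp
    then show ?thesis
      using tree_comp_eval[of 1 1 n lam tree_unit x U] assms r c True tree
      by (simp add: tree_unit_eq)
  qed
qed

lemma tree_unit_right:
  assumes i: "1 \<le> i" "i \<le> n" and "x \<in> tree_Op n"
  shows "tree_comp lam n 1 i x tree_unit = x"
proof
  fix U
  note eval = tree_comp_eval[OF i order_refl, of lam x tree_unit U]
  show "tree_comp lam n 1 i x tree_unit U = x U"
  proof (cases "U \<in> wtrees n")
    case False
    then show ?thesis
      using assms eval by (simp add: tree_Op_eq)
  next
    case True
    then have tree: "is_wtree U" and len: "length (weights U) = n"
      by (auto simp: wtrees_def)
    have "contract_block i 1 U = push_tree n id U"
      unfolding contract_block_def len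
      using push_cong[OF is_wtree_edges[OF tree], of "collapse i 1" id n] by (simp add: collapse_def)
    then have c: "contract_block i 1 U = U"
      using push_id[OF is_wtree_irrefl[OF tree] len] by simp
    have "parent_graph (restrict_block i 1 U)"
      by (rule parent_graph_restrict_block[OF is_wtree_parent_graph[OF tree] i(1)]) (use len i in simp)
    then have edges: "edges (restrict_block i 1 U) = {}" and w: "1 \<le> weight (restrict_block i 1 U) 1"
      by (auto simp: parent_graph_def verts_def irrefl_def)
    obtain k where k: "weights (restrict_block i 1 U) = [k]"
      using length_restrict_block[of i 1 U, unfolded One_nat_def length_Suc_conv] by auto
    have "restrict_block i 1 U = WTree [k] {}"
      using edges k by (cases "restrict_block i 1 U") auto
    then have r: "restrict_block i 1 U \<in> wtrees 1"
      unfolding wtrees_1 using w k by (auto simp: weight_def)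
    then have rtree: "is_wtree (restrict_block i 1 U)"
      by (simp add: wtrees_def)
    have "energy (restrict_block i 1 U) = 0"
      using energy_contract_restrict_le[OF i order_refl, of U] True rtree c by simp
    then show ?thesis
      using eval c r True rtree by (simp add: tree_unit_eq)
  qed
qed

theorem theorem11:
  fixes lam :: "'k::field_char_0"
  shows "multigraded_operad tscale tree_Op tree_act (tree_comp lam) tree_unit tree_Gr tree_proj"
proof unfold_locales
  fix n m p i j k :: nat and x x' y y' z :: "wtree \<Rightarrow> 'k" and c :: 'k
    and \<sigma> \<tau> :: "nat \<Rightarrow> nat" and a b :: "nat list"
  show "tree_space.subspace (tree_Op n :: (wtree \<Rightarrow> 'k) set)"
    by (rule tree_space.subspaceI) (auto simp: tree_Op_eq tscale_def)
  show "tree_space.subspace (tree_Gr a :: (wtree \<Rightarrow> 'k) set)"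
    unfolding tree_Gr_def by (rule tree_space.subspace_span)
  show "tree_act n x id = x" if "x \<in> tree_Op n"
    using that by (auto simp: fun_eq_iff tree_act_eval[OF permutes_id] tree_Op_eq wtrees_def relabel_id)
  show "tree_unit \<in> (tree_Op 1 :: (wtree \<Rightarrow> 'k) set)"
    by (simp add: tree_Op_eq tree_unit_eq)
  show "tree_comp lam 1 n 1 tree_unit x = x" if "1 \<le> n" "x \<in> tree_Op n"
    by (rule tree_unit_left[OF that])
  show "tree_Gr a \<subseteq> (tree_Op n :: (wtree \<Rightarrow> 'k) set)" if "a \<in> multidegrees n"
    by (rule tree_Gr_subset[OF that])
  show "tree_proj a (x + y) = tree_proj a x + tree_proj a y"
    "tree_proj a (tscale c x) = tscale c (tree_proj a x)"
    by (auto simp: tree_proj_def tscale_def fun_eq_iff)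
  show "tree_proj a x = x" if "x \<in> tree_Gr a"
    using that by (auto simp: tree_proj_def tree_Gr_eq fun_eq_iff)
  show "tree_proj b x = 0" if "a \<noteq> b" "x \<in> tree_Gr a"
    using that by (auto simp: tree_proj_def tree_Gr_eq fun_eq_iff)
  show "bij_betw (\<lambda>x. \<lambda>a\<in>multidegrees n. tree_proj a x) (tree_Op n)
      (\<Pi>\<^sub>E a\<in>multidegrees n. (tree_Gr a :: (wtree \<Rightarrow> 'k) set))"
    by (rule tree_Op_product)
  {
    assume \<sigma>: "\<sigma> permutes {1..n}"
    show "tree_act n x \<sigma> \<in> tree_Op n"
      by (rule tree_act_closed[OF \<sigma>])
    show "tree_act n (x + x') \<sigma> = tree_act n x \<sigma> + tree_act n x' \<sigma>"
      "tree_act n (tscale c x) \<sigma> = tscale c (tree_act n x \<sigma>)"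
      by (auto simp: fun_eq_iff tree_act_eval[OF \<sigma>] tscale_def)
    show "tree_act n (tree_act n x \<sigma>) \<tau> = tree_act n x (\<sigma> \<circ> \<tau>)" if "\<tau> permutes {1..n}"
      by (rule tree_act_act[OF \<sigma> that])
    show "(\<lambda>x. tree_act n x \<sigma>) ` tree_Gr a = (tree_Gr (perm_degree a \<sigma>) :: (wtree \<Rightarrow> 'k) set)"
      if "a \<in> multidegrees n"
      by (rule tree_Gr_act[OF \<sigma> that])
  }
  show "tree_comp lam n 1 i x tree_unit = x" if "1 \<le> i" "i \<le> n" "x \<in> tree_Op n"
    by (rule tree_unit_right[OF that])
  show "tree_comp lam (n + m - 1) p (k - 1 + m) (tree_comp lam n m i x y) z =
      tree_comp lam (n + p - 1) m i (tree_comp lam n p k x z) y"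
    if "1 \<le> i" "i < k" "k \<le> n" "1 \<le> m" "1 \<le> p"
    by (rule tree_comp_disjoint[OF that])
  show "tree_comp lam (n + m - 1) p (i - 1 + j) (tree_comp lam n m i x y) z =
      tree_comp lam n (m + p - 1) i x (tree_comp lam m p j y z)"
    if "1 \<le> i" "i \<le> n" "1 \<le> j" "j \<le> m" "1 \<le> p"
    by (rule tree_comp_nested[OF that])
  {
    assume i: "1 \<le> i" "i \<le> n" and m: "1 \<le> m"
    note eval = tree_comp_eval[OF i m]
    show "tree_comp lam n m i x y \<in> tree_Op (n + m - 1)"
      by (simp add: tree_Op_eq eval)
    show "tree_comp lam n m i (x + x') y = tree_comp lam n m i x y + tree_comp lam n m i x' y"
      "tree_comp lam n m i (tscale c x) y = tscale c (tree_comp lam n m i x y)"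
      "tree_comp lam n m i x (y + y') = tree_comp lam n m i x y + tree_comp lam n m i x y'"
      "tree_comp lam n m i x (tscale c y) = tscale c (tree_comp lam n m i x y)"
      by (auto simp: fun_eq_iff eval tscale_def algebra_simps)
    show "tree_comp lam n m i (tree_act n x \<sigma>) (tree_act m y \<tau>) =
        tree_act (n + m - 1) (tree_comp lam n m (\<sigma> i) x y) (perm_comp n m i \<sigma> \<tau>)"
      if "\<sigma> permutes {1..n}" "\<tau> permutes {1..m}"
      by (rule tree_comp_equivariant[OF i m that])
    show "tree_comp lam n m i x y \<in> tree_Gr (insert_degree i a b)"
      if "x \<in> tree_Gr a" "y \<in> tree_Gr b"
      by (rule tree_comp_Gr[OF i m that])
    show "tree_comp lam n m i x y = 0"
      if "x \<in> tree_Gr a" "y \<in> tree_Gr b" "sum_list b \<noteq> a ! (i - 1)"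
      by (rule tree_comp_Gr_zero[OF i m that])
  }
qed

end
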